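(* Let $\Lambda=k\Lambda_0+\lambda$ be a generic affine weight of non-critical level $k\neq-h^\vee$, and let $\widehat\mu,\widehat\mu'\in(\mathbb C^* )^{r+1}$. The Whittaker function $W_\Lambda^{\widehat\mu,\widehat\mu'}(\widehat\phi)={}^{\widehat\mu'}_\Lambda\langle w|e^{\sum_{i=0}^r\phi_ih_i}|w\rangle^{\widehat\mu}_\Lambda$ is the following generating series for the partition functions of the affine path model: $$W_\Lambda^{\widehat\mu,\widehat\mu'}(\widehat\phi)=\sum_{\widehat\beta\in\widehat Q_+}\Big(\prod_{i=0}^r(d_i\mu_i\mu_i')^{\beta_i}\Big)\,e^{(\Lambda-\widehat\beta|\widehat\phi)}\,Z_{\widehat\beta},$$ where $\widehat\phi=\sum_{i=0}^r\phi_i\alpha_i^\vee$, $\widehat\beta=\sum_{i=0}^r\beta_i\alpha_i$, and $Z_{\widehat\beta}=\sum_{\mathbf p\in\mathcal P_{\widehat\beta}}x(\mathbf p)$ with vertex weights $\widehat v(\widehat\beta)=(\Lambda+\widehat\rho|\widehat\beta)-\frac12(\widehat\beta|\widehat\beta)$.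
   Context: Affine data. $\widehat{\mathfrak g}=\mathfrak n_-\oplus\mathfrak h\oplus\mathfrak n_+$ is the non-twisted affine Lie algebra associated with a finite-dimensional simple Lie algebra $\mathfrak g$ of rank $r$, with simple roots $\alpha_0,\dots,\alpha_r$ ($\alpha_1,\dots,\alpha_r$ those of $\mathfrak g$), Cartan matrix $\widehat C$, and Chevalley generators $e_i,f_i,h_i$, $0\le i\le r$, with $[h_i,h_j]=0$, $[h_i,e_j]=\widehat C_{j,i}e_j$, $[h_i,f_j]=-\widehat C_{j,i}f_j$, $[e_i,f_j]=\delta_{i,j}h_j$ and the Serre relations. The positive numbers $d_i$ satisfy $\widehat C_{i,j}d_j=\widehat C_{j,i}d_i$ and $d_0=1$; $\alpha_i=d_i\alpha_i^\vee$; the symmetric bilinear form satisfies $(\alpha_i|\alpha_j^\vee)=\widehat C_{i,j}$. $\theta=\sum_{i=1}^ra_i\alpha_i$ is the highest root of $\mathfrak g$, $a_0=1$, $\delta=\alpha_0+\theta$; the co-marks are $a_i^\vee=d_ia_i$, $h^\vee=\sum_{i=0}^ra_i^\vee$ is the dual Coxeter number, and $c=\sum_ia_i^\vee h_i$ is central. $(\delta|\alpha_i)=(\delta|\delta)=0$, $(\Lambda_0|\alpha_j^\vee)=\delta_{j,0}$, $(\Lambda_0|\delta)=1$, $(\Lambda_0|\Lambda_0)=0$; $\omega_1,\dots,\omega_r$ are the fundamental weights of $\mathfrak g$, orthogonal to $\delta$ and $\Lambda_0$; $\rho=\sum_{i=1}^r\omega_i$; $\widehat\rho=h^\vee\Lambda_0+\rho$,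 so $(\widehat\rho|\alpha_i^\vee)=1$ for $0\le i\le r$. $\widehat Q_+=\bigoplus_{i=0}^r\mathbb Z_{\ge0}\alpha_i$. Verma module and dual. $\Lambda=k\Lambda_0+\lambda$ with $\lambda$ a weight of $\mathfrak g$ and $k\in\mathbb C$ not a positive integer. $V_\Lambda=U(\mathfrak n_-)|\Lambda\rangle$ is the (irreducible) Verma module, with $h_i|\Lambda\rangle=(\Lambda|\alpha_i^\vee)|\Lambda\rangle$, $\mathfrak n_+|\Lambda\rangle=0$, graded by $\widehat Q_+$ with finite-dimensional pieces ($f_{i_N}\cdots f_{i_1}|\Lambda\rangle$ has degree $\alpha_{i_1}+\dots+\alpha_{i_N}$); its completion is the product of these pieces. The dual right module is $V_\Lambda^*=\langle\Lambda|U(\mathfrak n_+)$ with $\langle\Lambda|\mathfrak n_-=0$, $\langle\Lambda|h_i=(\Lambda|\alpha_i^\vee)\langle\Lambda|$, $\langle\Lambda|\Lambda\rangle=1$, similarly completed, with pairing $(\langle\Lambda|a)(b|\Lambda\rangle)=\langle\Lambda|ab|\Lambda\rangle$. Whittaker vectors. $|w\rangle^{\widehat\mu}_\Lambda$ is the unique element of the completion of $V_\Lambda$ with $\langle\Lambda|w\rangle=1$ and $e_i|w\rangle=\mu_i|w\rangle$, $0\le i\le r$; ${}^{\widehat\mu'}_\Lambda\langle w|$ is the unique element of the completion of $V^*_\Lambda$ with $\langle w|\Lambda\rangle=1$ and $\langle w|f_i=\mu_i'\langle w|$, $0\le i\le r$. The $\phi_i$ are formal variables and the matrix element is the formal series obtained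 by summing over $\widehat\beta$ the pairings of the components of degree $\widehat\beta$, on which $e^{\sum_i\phi_ih_i}$ acts by $e^{(\Lambda-\widehat\beta|\widehat\phi)}$. Paths. $\mathcal P_{\widehat\beta}$ is the set of sequences $\mathbf p=(p_0,\dots,p_N)$ in $\widehat Q_+$ with $p_0=0$, $p_N=\widehat\beta$ and each $p_k-p_{k-1}\in\{\alpha_0,\dots,\alpha_r\}$; $x(\mathbf p)=\prod_{k=1}^N\frac1{\widehat v(p_k)}$ (equal to $1$ for the trivial path). "$\Lambda$ generic" means that $V_\Lambda$ is irreducible and $\widehat v(\widehat\beta)\neq0$ for all $\widehat\beta\in\widehat Q_+\setminus\{0\}$. *)

theory Defs
  imports "HOL-Analysis.Analysis" "HOL-Library.Poly_Mapping"
begin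

section \<open>Affine data\<close>

text \<open>
  The nodes of the Dynkin diagram of the simple Lie algebra \<open>\<gg>\<close> of rank \<open>r = CARD('n)\<close> are
  the elements of a finite type \<open>'n\<close>; those of the affine diagram are the elements of \<open>'n option\<close>,
  where \<open>None\<close> is the affine node \<open>0\<close>.  An element of the positive cone of the affine root lattice
  is the function \<open>\<beta> :: 'n option \<Rightarrow> nat\<close> of its coefficients on the simple roots.
\<close>

definition gen_cartan_matrix :: "('i \<Rightarrow> 'i \<Rightarrow> int) \<Rightarrow> bool" where
  "gen_cartan_matrix C \<longleftrightarrow> (\<forall>i. C i i = 2) \<and> (\<forall>i j. i \<noteq> j \<longrightarrow> C i j \<le> 0) \<and>
     (\<forall>i j. C i j = 0 \<longleftrightarrow> C j i = 0)"

definition indecomposable :: "('i \<Rightarrow> 'i \<Rightarrow> int) \<Rightarrow> bool" where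
  "indecomposable C \<longleftrightarrow>
     (\<forall>S. S \<noteq> {} \<and> S \<noteq> UNIV \<longrightarrow> (\<exists>i\<in>S. \<exists>j\<in>-S. C i j \<noteq> 0))"

text \<open>The Cartan matrices of the finite-dimensional simple complex Lie algebras.\<close>

definition simple_cartan_matrix :: "('n::finite \<Rightarrow> 'n \<Rightarrow> int) \<Rightarrow> bool" where
  "simple_cartan_matrix C \<longleftrightarrow> gen_cartan_matrix C \<and> indecomposable C \<and>
     (\<exists>D :: 'n \<Rightarrow> real. (\<forall>i. D i > 0) \<and>
        (\<forall>i j. of_int (C i j) * D j = of_int (C j i) * D i) \<and>
        (\<forall>x :: 'n \<Rightarrow> real. x \<noteq> (\<lambda>_. 0) \<longrightarrow>
           (\<Sum>i\<in>UNIV. \<Sum>j\<in>UNIV. x i * x j * (of_int (C i j) * D j)) > 0))"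

text \<open>
  Roots of a simple Lie algebra, in coordinates on the simple roots, as the Weyl group orbits of
  the simple roots.  Convention throughout: \<open>C i j\<close> is the pairing of the \<open>i\<close>-th simple root with
  the \<open>j\<close>-th simple coroot.
\<close>

inductive_set roots :: "('n::finite \<Rightarrow> 'n \<Rightarrow> int) \<Rightarrow> ('n \<Rightarrow> int) set"
  for C :: "'n \<Rightarrow> 'n \<Rightarrow> int" where
  simple: "(\<lambda>j. if j = i then 1 else 0) \<in> roots C"
| reflect: "\<beta> \<in> roots C \<Longrightarrow> \<beta>(i := \<beta> i - (\<Sum>j\<in>UNIV. \<beta> j * C j i)) \<in> roots C"

definition highest_root :: "('n::finite \<Rightarrow> 'n \<Rightarrow> int) \<Rightarrow> ('n \<Rightarrow> int) \<Rightarrow> bool" where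
  "highest_root C \<theta> \<longleftrightarrow> \<theta> \<in> roots C \<and> (\<forall>\<beta>\<in>roots C. \<forall>i. \<beta> i \<le> \<theta> i)"

record 'n affine_data =
  cartan :: "'n option \<Rightarrow> 'n option \<Rightarrow> int"  \<comment> \<open>\<open>C\<^sub>i\<^sub>j\<close>\<close>
  symm :: "'n option \<Rightarrow> real"                  \<comment> \<open>\<open>d\<^sub>i\<close>\<close>
  mark :: "'n option \<Rightarrow> nat"                   \<comment> \<open>\<open>a\<^sub>i\<close>\<close>

text \<open>
  The last condition says that \<open>\<delta> = \<Sum> a\<^sub>i \<alpha>\<^sub>i = \<alpha>\<^sub>0 + \<theta>\<close> is orthogonal to all simple coroots.
  Together with the symmetrization and \<open>d\<^sub>0 = 1\<close> it determines the row and the column of the affine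
  node (namely \<open>C\<^sub>0\<^sub>j = -(\<theta>|\<alpha>\<^sub>j\<^sup>\<or>)\<close> and \<open>C\<^sub>j\<^sub>0 = -(\<alpha>\<^sub>j|\<theta>)\<close> with \<open>(\<theta>|\<theta>) = 2\<close>) and all the \<open>d\<^sub>i\<close> from the
  finite Cartan matrix, so that the matrix is its non-twisted affine extension.
\<close>

definition untwisted_affine :: "'n::finite affine_data \<Rightarrow> bool" where
  "untwisted_affine G \<longleftrightarrow>
     gen_cartan_matrix (cartan G) \<and>
     simple_cartan_matrix (\<lambda>i j. cartan G (Some i) (Some j)) \<and>
     (\<forall>i. symm G i > 0) \<and> symm G None = 1 \<and>
     (\<forall>i j. of_int (cartan G i j) * symm G j = of_int (cartan G j i) * symm G i) \<and>
     mark G None = 1 \<and>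
     highest_root (\<lambda>i j. cartan G (Some i) (Some j)) (\<lambda>i. int (mark G (Some i))) \<and>
     (\<forall>j. (\<Sum>i\<in>UNIV. int (mark G i) * cartan G i j) = 0)"


section \<open>Weights and the bilinear form\<close>

text \<open>The pair \<open>(k, x)\<close> stands for \<open>k \<Lambda>\<^sub>0 + \<Sum> x\<^sub>i \<alpha>\<^sub>i\<close>.\<close>

type_synonym 'n weight = "complex \<times> (complex ^ 'n option)"

definition wscale :: "complex \<Rightarrow> 'n::finite weight \<Rightarrow> 'n weight" where
  "wscale c X = (c * fst X, c *s snd X)"

definition Lambda0 :: "'n::finite weight" where
  "Lambda0 = (1, 0)"

definition simple_root :: "'n::finite option \<Rightarrow> 'n weight" where
  "simple_root i = (0, axis i 1)"

text \<open>
  Since \<open>\<alpha>\<^sub>i = d\<^sub>i \<alpha>\<^sub>i\<^sup>\<or>\<close>, one has \<open>(\<alpha>\<^sub>i|\<alpha>\<^sub>j) = C\<^sub>i\<^sub>j d\<^sub>j\<close> and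
  \<open>(\<Lambda>\<^sub>0|\<alpha>\<^sub>j) = d\<^sub>j \<delta>\<^sub>j\<^sub>0 = \<delta>\<^sub>j\<^sub>0\<close>; moreover \<open>(\<Lambda>\<^sub>0|\<Lambda>\<^sub>0) = 0\<close>.
\<close>

definition form :: "'n::finite affine_data \<Rightarrow> 'n weight \<Rightarrow> 'n weight \<Rightarrow> complex" where
  "form G X Y =
     (\<Sum>i\<in>UNIV. \<Sum>j\<in>UNIV. of_int (cartan G i j) * of_real (symm G j) * (snd X $ i) * (snd Y $ j))
     + fst X * (snd Y $ None) + (snd X $ None) * fst Y"

definition coroot :: "'n::finite affine_data \<Rightarrow> 'n option \<Rightarrow> 'n weight" where
  "coroot G i = wscale (1 / of_real (symm G i)) (simple_root i)"

definition delta :: "'n::finite affine_data \<Rightarrow> 'n weight" where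
  "delta G = (\<Sum>i\<in>UNIV. wscale (of_nat (mark G i)) (simple_root i))"

definition dual_coxeter :: "'n::finite affine_data \<Rightarrow> complex" where
  "dual_coxeter G = (\<Sum>i\<in>UNIV. of_real (symm G i) * of_nat (mark G i))"

text \<open>Weights of \<open>\<gg>\<close>: the complex span of \<open>\<alpha>\<^sub>1, \<dots>, \<alpha>\<^sub>r\<close>.\<close>

definition fin_weights :: "'n::finite weight set" where
  "fin_weights = {X. fst X = 0 \<and> snd X $ None = 0}"

definition fund_weight :: "'n::finite affine_data \<Rightarrow> 'n \<Rightarrow> 'n weight" where
  "fund_weight G i = (THE X. form G X (delta G) = 0 \<and> form G X Lambda0 = 0 \<and>
     (\<forall>j. form G X (coroot G (Some j)) = (if i = j then 1 else 0)))"

definition rho_hat :: "'n::finite affine_data \<Rightarrow> 'n weight" where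
  "rho_hat G = wscale (dual_coxeter G) Lambda0 + (\<Sum>i\<in>UNIV. fund_weight G i)"

definition root_vec :: "('n::finite option \<Rightarrow> nat) \<Rightarrow> 'n weight" where
  "root_vec \<beta> = (\<Sum>i\<in>UNIV. wscale (of_nat (\<beta> i)) (simple_root i))"


section \<open>The enveloping algebra of the affine Lie algebra\<close>

datatype 'i gen = Egen 'i | Fgen 'i | Hgen 'i

text \<open>
  Words form the free monoid (written additively, as the library class demands), so that finitely
  supported functions on words with their convolution product are the free associative algebra.
\<close>

datatype 'g word = Word "'g list"

instantiation word :: (type) monoid_add
begin

definition zero_word :: "'a word" where
  "zero_word = Word []"

fun plus_word :: "'a word \<Rightarrow> 'a word \<Rightarrow> 'a word" where
  "plus_word (Word u) (Word v) = Word (u @ v)"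

instance
proof
  fix a b c :: "'a word"
  show "a + b + c = a + (b + c)"
    by (cases a; cases b; cases c) simp
  show "0 + a = a" "a + 0 = a"
    by (cases a; simp add: zero_word_def)+
qed

end

type_synonym 'n falg = "'n option gen word \<Rightarrow>\<^sub>0 complex"

definition gen_elt :: "'n option gen \<Rightarrow> 'n falg" where
  "gen_elt g = Poly_Mapping.single (Word [g]) 1"

definition scal :: "complex \<Rightarrow> 'n falg" where
  "scal c = Poly_Mapping.single 0 c"

abbreviation e_elt :: "'n option \<Rightarrow> 'n falg" where "e_elt i \<equiv> gen_elt (Egen i)"
abbreviation f_elt :: "'n option \<Rightarrow> 'n falg" where "f_elt i \<equiv> gen_elt (Fgen i)"
abbreviation h_elt :: "'n option \<Rightarrow> 'n falg" where "h_elt i \<equiv> gen_elt (Hgen i)"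

definition comm :: "'a::ring_1 \<Rightarrow> 'a \<Rightarrow> 'a" where
  "comm x y = x * y - y * x"

text \<open>
  Elements of the free algebra that vanish in the enveloping algebra of the Lie algebra presented
  by the Chevalley generators: the Chevalley relations and the Serre relations
  \<open>(ad e\<^sub>i)\<^bsup>1 - C\<^sub>j\<^sub>i\<^esup> e\<^sub>j = 0 = (ad f\<^sub>i)\<^bsup>1 - C\<^sub>j\<^sub>i\<^esup> f\<^sub>j\<close> for \<open>i \<noteq> j\<close>.
\<close>

inductive_set relators :: "'n::finite affine_data \<Rightarrow> 'n falg set"
  for G :: "'n affine_data" where
  hh: "comm (h_elt i) (h_elt j) \<in> relators G"
| he: "comm (h_elt i) (e_elt j) - scal (of_int (cartan G j i)) * e_elt j \<in> relators G"
| hf: "comm (h_elt i) (f_elt j) + scal (of_int (cartan G j i)) * f_elt j \<in> relators G"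
| ef: "comm (e_elt i) (f_elt j) - (if i = j then h_elt j else 0) \<in> relators G"
| serre_e: "i \<noteq> j \<Longrightarrow> (comm (e_elt i) ^^ nat (1 - cartan G j i)) (e_elt j) \<in> relators G"
| serre_f: "i \<noteq> j \<Longrightarrow> (comm (f_elt i) ^^ nat (1 - cartan G j i)) (f_elt j) \<in> relators G"

inductive_set two_sided_ideal :: "'a::ring_1 set \<Rightarrow> 'a set" for S :: "'a set" where
  zero: "0 \<in> two_sided_ideal S"
| add: "x \<in> two_sided_ideal S \<Longrightarrow> s \<in> S \<Longrightarrow> x + a * s * b \<in> two_sided_ideal S"

inductive_set left_ideal :: "'a::ring_1 set \<Rightarrow> 'a set" for S :: "'a set" where
  zero: "0 \<in> left_ideal S"
| add: "x \<in> left_ideal S \<Longrightarrow> s \<in> S \<Longrightarrow> x + a * s \<in> left_ideal S"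

inductive_set right_ideal :: "'a::ring_1 set \<Rightarrow> 'a set" for S :: "'a set" where
  zero: "0 \<in> right_ideal S"
| add: "x \<in> right_ideal S \<Longrightarrow> s \<in> S \<Longrightarrow> x + s * a \<in> right_ideal S"

text \<open>The enveloping algebra is the quotient of the free algebra by this ideal.\<close>

definition uea_ideal :: "'n::finite affine_data \<Rightarrow> 'n falg set" where
  "uea_ideal G = two_sided_ideal (relators G)"


section \<open>The Verma module and its dual\<close>

text \<open>
  The Verma module \<open>V\<^sub>\<Lambda>\<close> is the quotient of the free algebra by the annihilator of the highest
  weight vector; its elements are cosets, and \<open>verma_vec G \<Lambda> u\<close> is \<open>u|\<Lambda>\<rangle>\<close>.  Likewise for the
  dual right module, with \<open>dual_vec G \<Lambda> u\<close> being \<open>\<langle>\<Lambda>|u\<close>.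
\<close>

definition verma_ideal :: "'n::finite affine_data \<Rightarrow> 'n weight \<Rightarrow> 'n falg set" where
  "verma_ideal G \<Lambda> =
     left_ideal (uea_ideal G \<union> range e_elt \<union> range (\<lambda>i. h_elt i - scal (form G \<Lambda> (coroot G i))))"

definition verma_vec :: "'n::finite affine_data \<Rightarrow> 'n weight \<Rightarrow> 'n falg \<Rightarrow> 'n falg set" where
  "verma_vec G \<Lambda> u = {u + j |j. j \<in> verma_ideal G \<Lambda>}"

definition verma_space :: "'n::finite affine_data \<Rightarrow> 'n weight \<Rightarrow> 'n falg set set" where
  "verma_space G \<Lambda> = range (verma_vec G \<Lambda>)"

definition verma_act ::
    "'n::finite affine_data \<Rightarrow> 'n weight \<Rightarrow> 'n falg \<Rightarrow> 'n falg set \<Rightarrow> 'n falg set" where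
  "verma_act G \<Lambda> a X = {a * x + j |x j. x \<in> X \<and> j \<in> verma_ideal G \<Lambda>}"

definition dual_ideal :: "'n::finite affine_data \<Rightarrow> 'n weight \<Rightarrow> 'n falg set" where
  "dual_ideal G \<Lambda> =
     right_ideal (uea_ideal G \<union> range f_elt \<union> range (\<lambda>i. h_elt i - scal (form G \<Lambda> (coroot G i))))"

definition dual_vec :: "'n::finite affine_data \<Rightarrow> 'n weight \<Rightarrow> 'n falg \<Rightarrow> 'n falg set" where
  "dual_vec G \<Lambda> u = {u + j |j. j \<in> dual_ideal G \<Lambda>}"

definition dual_act ::
    "'n::finite affine_data \<Rightarrow> 'n weight \<Rightarrow> 'n falg set \<Rightarrow> 'n falg \<Rightarrow> 'n falg set" where
  "dual_act G \<Lambda> X a = {x * a + j |x j. x \<in> X \<and> j \<in> dual_ideal G \<Lambda>}"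

text \<open>
  Homogeneous components: \<open>words_of_degree K \<beta>\<close> is the span of the words in the generators
  \<open>K i\<close> (\<open>K = Egen\<close> or \<open>Fgen\<close>) in which each \<open>K i\<close> occurs \<open>\<beta> i\<close> times.
\<close>

definition words_of_degree ::
    "('n option \<Rightarrow> 'n option gen) \<Rightarrow> ('n option \<Rightarrow> nat) \<Rightarrow> 'n falg set" where
  "words_of_degree K \<beta> =
     {u. \<forall>w\<in>Poly_Mapping.keys u. \<exists>is. w = Word (map K is) \<and> (\<forall>i. count_list is i = \<beta> i)}"

definition verma_piece ::
    "'n::finite affine_data \<Rightarrow> 'n weight \<Rightarrow> ('n option \<Rightarrow> nat) \<Rightarrow> 'n falg set set" where
  "verma_piece G \<Lambda> \<beta> = verma_vec G \<Lambda> ` words_of_degree Fgen \<beta>"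

definition dual_piece ::
    "'n::finite affine_data \<Rightarrow> 'n weight \<Rightarrow> ('n option \<Rightarrow> nat) \<Rightarrow> 'n falg set set" where
  "dual_piece G \<Lambda> \<beta> = dual_vec G \<Lambda> ` words_of_degree Egen \<beta>"

text \<open>
  \<open>\<langle>\<Lambda>|u|\<Lambda>\<rangle>\<close>: because of \<open>\<langle>\<Lambda>|\<Lambda>\<rangle> = 1\<close>, it is the scalar \<open>c\<close> to which \<open>u\<close> reduces when
  the relations satisfied by \<open>\<langle>\<Lambda>|\<close> on the left and by \<open>|\<Lambda>\<rangle>\<close> on the right are imposed.
\<close>

definition vac_expect :: "'n::finite affine_data \<Rightarrow> 'n weight \<Rightarrow> 'n falg \<Rightarrow> complex" where
  "vac_expect G \<Lambda> u =
     (THE c. \<exists>l\<in>dual_ideal G \<Lambda>. \<exists>r\<in>verma_ideal G \<Lambda>. u = scal c + l + r)"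

definition pairing ::
    "'n::finite affine_data \<Rightarrow> 'n weight \<Rightarrow> 'n falg set \<Rightarrow> 'n falg set \<Rightarrow> complex" where
  "pairing G \<Lambda> X Y = (THE c. \<forall>x\<in>X. \<forall>y\<in>Y. vac_expect G \<Lambda> (x * y) = c)"

definition verma_submodule ::
    "'n::finite affine_data \<Rightarrow> 'n weight \<Rightarrow> 'n falg set set \<Rightarrow> bool" where
  "verma_submodule G \<Lambda> N \<longleftrightarrow> N \<subseteq> verma_space G \<Lambda> \<and> verma_vec G \<Lambda> 0 \<in> N \<and>
     (\<forall>u v. verma_vec G \<Lambda> u \<in> N \<and> verma_vec G \<Lambda> v \<in> N \<longrightarrow> verma_vec G \<Lambda> (u + v) \<in> N) \<and>
     (\<forall>a. \<forall>X\<in>N. verma_act G \<Lambda> a X \<in> N)"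

definition verma_irreducible :: "'n::finite affine_data \<Rightarrow> 'n weight \<Rightarrow> bool" where
  "verma_irreducible G \<Lambda> \<longleftrightarrow> verma_space G \<Lambda> \<noteq> {verma_vec G \<Lambda> 0} \<and>
     (\<forall>N. verma_submodule G \<Lambda> N \<longrightarrow> N = {verma_vec G \<Lambda> 0} \<or> N = verma_space G \<Lambda>)"


section \<open>Whittaker vectors and the Whittaker function\<close>

text \<open>
  An element of the completion is the family of its homogeneous components.  The generator
  \<open>e\<^sub>i\<close> lowers the degree by \<open>\<alpha>\<^sub>i\<close>, so the component of degree \<open>\<beta>\<close> of \<open>e\<^sub>i|w\<rangle>\<close> is
  \<open>e\<^sub>i\<close> applied to the component of degree \<open>\<beta> + \<alpha>\<^sub>i\<close> of \<open>|w\<rangle>\<close>; similarly for \<open>\<langle>w|f\<^sub>i\<close>.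
\<close>

definition add_root :: "('i \<Rightarrow> nat) \<Rightarrow> 'i \<Rightarrow> ('i \<Rightarrow> nat)" where
  "add_root \<beta> i = \<beta>(i := \<beta> i + 1)"

definition whittaker_vec ::
    "'n::finite affine_data \<Rightarrow> 'n weight \<Rightarrow> ('n option \<Rightarrow> complex) \<Rightarrow>
     ('n option \<Rightarrow> nat) \<Rightarrow> 'n falg set" where
  "whittaker_vec G \<Lambda> \<mu> =
     (THE w. (\<forall>\<beta>. w \<beta> \<in> verma_piece G \<Lambda> \<beta>) \<and>
        pairing G \<Lambda> (dual_vec G \<Lambda> 1) (w (\<lambda>_. 0)) = 1 \<and>
        (\<forall>i \<beta>. verma_act G \<Lambda> (e_elt i) (w (add_root \<beta> i)) = verma_act G \<Lambda> (scal (\<mu> i)) (w \<beta>)))"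

definition dual_whittaker_vec ::
    "'n::finite affine_data \<Rightarrow> 'n weight \<Rightarrow> ('n option \<Rightarrow> complex) \<Rightarrow>
     ('n option \<Rightarrow> nat) \<Rightarrow> 'n falg set" where
  "dual_whittaker_vec G \<Lambda> \<mu>' =
     (THE w. (\<forall>\<beta>. w \<beta> \<in> dual_piece G \<Lambda> \<beta>) \<and>
        pairing G \<Lambda> (w (\<lambda>_. 0)) (verma_vec G \<Lambda> 1) = 1 \<and>
        (\<forall>i \<beta>. dual_act G \<Lambda> (w (add_root \<beta> i)) (f_elt i) = dual_act G \<Lambda> (w \<beta>) (scal (\<mu>' i))))"

text \<open>
  The formal series \<open>\<langle>w|exp(\<Sum> \<phi>\<^sub>i h\<^sub>i)|w\<rangle>\<close> is given by its family of terms: the term of degree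
  \<open>\<beta>\<close> is the pairing of the components of degree \<open>\<beta>\<close>, with the operator exponential expanded as
  a power series; it is a function of the variables \<open>\<phi>\<close>.  No convergence of the sum over \<open>\<beta>\<close> is
  meant.  The series has to be indexed by \<open>\<beta>\<close> and not by the exponents \<open>(\<Lambda> - \<beta>|\<phi>)\<close>,
  which do not separate \<open>\<beta>\<close> from \<open>\<beta> + \<delta>\<close>.
\<close>

type_synonym 'n series = "('n option \<Rightarrow> nat) \<Rightarrow> ('n option \<Rightarrow> complex) \<Rightarrow> complex"

definition whittaker_function ::
    "'n::finite affine_data \<Rightarrow> 'n weight \<Rightarrow> ('n option \<Rightarrow> complex) \<Rightarrow> ('n option \<Rightarrow> complex) \<Rightarrow>
     'n series" where
  "whittaker_function G \<Lambda> \<mu> \<mu>' = (\<lambda>\<beta> \<phi>. suminf (\<lambda>n.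
     pairing G \<Lambda> (dual_whittaker_vec G \<Lambda> \<mu>' \<beta>)
       (verma_act G \<Lambda> ((\<Sum>i\<in>UNIV. scal (\<phi> i) * h_elt i) ^ n) (whittaker_vec G \<Lambda> \<mu> \<beta>)) / fact n))"


section \<open>The affine path model\<close>

definition vertex_weight ::
    "'n::finite affine_data \<Rightarrow> 'n weight \<Rightarrow> ('n option \<Rightarrow> nat) \<Rightarrow> complex" where
  "vertex_weight G \<Lambda> \<beta> =
     form G (\<Lambda> + rho_hat G) (root_vec \<beta>) - form G (root_vec \<beta>) (root_vec \<beta>) / 2"

definition paths :: "('i \<Rightarrow> nat) \<Rightarrow> ('i \<Rightarrow> nat) list set" where
  "paths \<beta> = {p. p \<noteq> [] \<and> hd p = (\<lambda>_. 0) \<and> last p = \<beta> \<and>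
     (\<forall>k. Suc k < length p \<longrightarrow> (\<exists>i. p ! Suc k = add_root (p ! k) i))}"

definition path_weight ::
    "'n::finite affine_data \<Rightarrow> 'n weight \<Rightarrow> ('n option \<Rightarrow> nat) list \<Rightarrow> complex" where
  "path_weight G \<Lambda> p = (\<Prod>k = 1..<length p. 1 / vertex_weight G \<Lambda> (p ! k))"

text \<open>The sum is finite; see \<open>finite_paths\<close> below.\<close>

definition partition_function ::
    "'n::finite affine_data \<Rightarrow> 'n weight \<Rightarrow> ('n option \<Rightarrow> nat) \<Rightarrow> complex" where
  "partition_function G \<Lambda> \<beta> = (\<Sum>p\<in>paths \<beta>. path_weight G \<Lambda> p)"

lemma finite_paths: "finite (paths (\<beta> :: 'i::finite \<Rightarrow> nat))"
proof -
  have cnt: "(\<Sum>j\<in>UNIV. (p ! k) j) = k"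
    if p: "p \<in> paths \<beta>" and k: "k < length p" for p k
    using k
  proof (induction k)
    case 0
    then show ?case using p by (simp add: paths_def hd_conv_nth)
  next
    case (Suc k)
    obtain i where i: "p ! Suc k = add_root (p ! k) i"
      using p Suc.prems by (auto simp: paths_def)
    have "(\<Sum>j\<in>UNIV. (p ! Suc k) j) = (\<Sum>j\<in>UNIV. (p ! k) j + (if j = i then 1 else 0))"
      unfolding i add_root_def by (intro sum.cong) auto
    also have "\<dots> = Suc k" using Suc by (simp add: sum.distrib)
    finally show ?case .
  qed
  let ?N = "\<Sum>j\<in>UNIV. \<beta> j"
  have "paths \<beta> \<subseteq> {p. set p \<subseteq> {\<gamma>. \<forall>j. \<gamma> j \<in> {..?N}} \<and> length p = Suc ?N}"
  proof (intro subsetI CollectI conjI)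
    fix p assume p: "p \<in> paths \<beta>"
    then have ne: "p \<noteq> []" and l: "last p = \<beta>" by (auto simp: paths_def)
    have "?N = length p - 1"
      using cnt[OF p, of "length p - 1"] ne l by (simp add: last_conv_nth)
    then show len: "length p = Suc ?N" using ne by (cases p) auto
    show "\<forall>j. \<gamma> j \<in> {..?N}" if g: "\<gamma> \<in> set p" for \<gamma>
    proof
      fix j
      obtain k where k: "k < length p" "\<gamma> = p ! k" using g by (auto simp: in_set_conv_nth)
      have "\<gamma> j \<le> (\<Sum>j\<in>UNIV. \<gamma> j)" by (intro member_le_sum) auto
      also have "\<dots> = k" using cnt[OF p k(1)] k(2) by simp
      finally show "\<gamma> j \<in> {..?N}" using k(1) len by simp
    qed
  qed
  moreover have "finite {\<gamma> :: 'i \<Rightarrow> nat. \<forall>j. \<gamma> j \<in> {..?N}}"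
    using finite_PiE[of "UNIV :: 'i set" "\<lambda>_. {..?N}"] by (simp add: PiE_def Pi_def)
  ultimately show ?thesis
    using finite_lists_length_eq finite_subset by blast
qed

definition generic :: "'n::finite affine_data \<Rightarrow> 'n weight \<Rightarrow> bool" where
  "generic G \<Lambda> \<longleftrightarrow> verma_irreducible G \<Lambda> \<and>
     (\<forall>\<beta>. \<beta> \<noteq> (\<lambda>_. 0) \<longrightarrow> vertex_weight G \<Lambda> \<beta> \<noteq> 0)"

end

theory Submission
  imports Defs
begin

text \<open>
  The vectors \<open>w\<^sub>\<beta>\<close> defined by \<open>v(\<beta>) w\<^sub>\<beta> = \<Sum>\<^sub>i d\<^sub>i \<mu>\<^sub>i f\<^sub>i w\<^bsub>\<beta> - \<alpha>\<^sub>i\<^esub>\<close> satisfy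
  \<open>e\<^sub>j w\<^sub>\<beta> = \<mu>\<^sub>j w\<^bsub>\<beta> - \<alpha>\<^sub>j\<^esub>\<close>, by induction on \<open>\<beta>\<close>, because
  \<open>v(\<beta>) - v(\<beta> - \<alpha>\<^sub>j) = (\<Lambda> - \<beta> + \<alpha>\<^sub>j|\<alpha>\<^sub>j)\<close>; irreducibility makes them the only solution.
  The dual Whittaker vector is the image of the Whittaker vector under
  the anti-involution exchanging \<open>e\<^sub>i\<close> and \<open>f\<^sub>i\<close>, and moving \<open>f\<^sub>i\<close> to the left in the pairing of
  the two turns the recursion for \<open>w\<^sub>\<beta>\<close> into the recursion of the path sum for its last step.
\<close>

section \<open>The free algebra\<close>

text \<open>The recursion is the quadratic Casimir in disguise: with \<rho> standing for
  \<open>rho_hat\<close>, v(\<beta>) is half of |\<Lambda>+\<rho>|^2 - |\<Lambda>+\<rho>-\<beta>|^2,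
  and d_i enters because h_i belongs to a coroot while v is measured with roots. The obstacle is
  that all objects are cosets in a free algebra picked by definite descriptions, whose meaning has
  to be established. A vacuum expectation is well defined only if no nonzero scalar is a sum of an
  element of the dual ideal and one of the Verma ideal. Irreducibility, which includes that the
  module is nonzero, keeps 1 out of the Verma ideal; the integer grading with f in degree 1 and e in
  degree -1 extends this to the sum of the two ideals. The same grading gives uniqueness: a lowest
  nonzero difference of two normalized solutions would be killed by all e_i and generate a submodule
  in positive degrees, which cannot contain the vacuum. The work is done on representatives modulo
  the left ideal, and the right module is reached through the anti-involution.\<close>

lemma poly_mapping_induct_on [consumes 1, case_names zero add]:
  fixes p :: "'a \<Rightarrow>\<^sub>0 'b::monoid_add"
  assumes "Poly_Mapping.keys p \<subseteq> A" and "P 0"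
    and step: "\<And>k c p. k \<in> A \<Longrightarrow> P p \<Longrightarrow> P (p + Poly_Mapping.single k c)"
  shows "P p"
  using assms(1)
proof (induction p rule: update_induct)
  case const
  show ?case by fact
next
  case (update p a b)
  have "Poly_Mapping.update a b p = p + Poly_Mapping.single a b"
    using update(1) by (intro poly_mapping_eqI)
      (auto simp: lookup_update lookup_add lookup_single when_def in_keys_iff)
  moreover have "Poly_Mapping.keys p \<subseteq> A" "a \<in> A"
    using update(2,4) by (auto simp: keys_update)
  ultimately show ?case using update(3) step by simp
qed

lemmas poly_mapping_induct_single = poly_mapping_induct_on[OF subset_UNIV, case_names zero add]

definition mon :: "'n option gen list \<Rightarrow> 'n falg" where
  "mon xs = Poly_Mapping.single (Word xs) 1"

lemma mon_Nil [simp]: "mon [] = 1"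
  by (metis mon_def single_one zero_word_def)

lemma mon_Cons: "mon (g # xs) = gen_elt g * mon xs"
  by (simp add: mon_def gen_elt_def mult_single)

lemma single_eq_scal_mon: "Poly_Mapping.single (Word xs) c = scal c * mon xs"
  by (simp add: mon_def scal_def mult_single)

lemma scal_0 [simp]: "scal 0 = 0" and scal_1 [simp]: "scal 1 = 1"
  by (simp_all add: scal_def)

lemma scal_add: "scal (a + b) = scal a + scal b"
  and scal_diff: "scal (a - b) = scal a - scal b"
  by (simp_all add: scal_def single_add single_diff)

lemma scal_mult: "scal a * scal b = scal (a * b)"
  by (simp add: scal_def mult_single)

lemma scal_mult_left: "scal a * (scal b * u) = scal (a * b) * u"
  by (simp add: scal_mult flip: mult.assoc)

lemma scal_commute: "u * scal c = scal c * u"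
proof (induction u rule: poly_mapping_induct_single)
  case (add k d p)
  then show ?case by (simp add: distrib_left distrib_right scal_def mult_single mult.commute)
qed simp

lemma gen_scal: "gen_elt g * scal c = scal c * gen_elt g"
  "gen_elt g * (scal c * u) = scal c * (gen_elt g * u)"
  by (simp_all add: scal_commute flip: mult.assoc)

lemma mult_scal_left: "a * (scal c * u) = scal c * (a * u)"
  by (metis mult.assoc scal_commute)

lemma scal_mult_both: "(scal c * u) * (scal d * v) = scal (c * d) * (u * v)"
  using mult_scal_left[of u d v] by (simp only: mult.assoc flip: scal_mult)

lemma scal_sum: "scal (sum f A) = (\<Sum>i\<in>A. scal (f i))"
  by (induction A rule: infinite_finite_induct) (auto simp: scal_add)

lemma falg_induct_on [consumes 1, case_names zero add]:
  assumes "Poly_Mapping.keys (p :: 'n falg) \<subseteq> Word ` A" and "P 0"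
    and "\<And>xs c p. xs \<in> A \<Longrightarrow> P p \<Longrightarrow> P (p + scal c * mon xs)"
  shows "P p"
  using assms by (induction p rule: poly_mapping_induct_on) (auto simp: single_eq_scal_mon)

lemma range_Word: "Word ` UNIV = UNIV"
  by (metis (full_types) UNIV_eq_I rangeI word.exhaust)

lemma falg_induct [case_names zero add]:
  assumes "P (0 :: 'n falg)"
    and "\<And>xs c p. P p \<Longrightarrow> P (p + scal c * mon xs)"
  shows "P p"
  by (rule falg_induct_on[of p UNIV P]) (simp_all add: range_Word assms)

section \<open>The principal integer grading of the free algebra\<close>

fun gdeg :: "'i gen \<Rightarrow> int" where
  "gdeg (Egen i) = -1" | "gdeg (Fgen i) = 1" | "gdeg (Hgen i) = 0"

fun wdeg :: "'i gen word \<Rightarrow> int" where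
  "wdeg (Word xs) = sum_list (map gdeg xs)"

lemma wdeg_plus: "wdeg (u + v) = wdeg u + wdeg v"
  by (cases u; cases v) simp

text \<open>Zero is homogeneous of every degree. The signs of \<open>gdeg\<close> are chosen so that
  the Verma module lives in degrees \<ge> 0 with the vacuum in degree 0.\<close>

definition homog :: "int \<Rightarrow> 'n falg \<Rightarrow> bool" where
  "homog d u \<longleftrightarrow> (\<forall>w\<in>Poly_Mapping.keys u. wdeg w = d)"

lemma homog_0 [simp]: "homog d 0"
  by (simp add: homog_def)

lemma homog_add: "homog d u \<Longrightarrow> homog d v \<Longrightarrow> homog d (u + v)"
  unfolding homog_def using keys_add[of u v] by blast

lemma homog_diff: "homog d u \<Longrightarrow> homog d v \<Longrightarrow> homog d (u - v)"
  unfolding homog_def by (auto simp: in_keys_iff lookup_minus)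

lemma homog_mult: "homog d u \<Longrightarrow> homog e v \<Longrightarrow> d + e = n \<Longrightarrow> homog n (u * v)"
  unfolding homog_def
proof
  fix w assume uv: "\<forall>w\<in>Poly_Mapping.keys u. wdeg w = d" "\<forall>w\<in>Poly_Mapping.keys v. wdeg w = e"
    and n: "d + e = n" and "w \<in> Poly_Mapping.keys (u * v)"
  then obtain a b where "w = a + b" "a \<in> Poly_Mapping.keys u" "b \<in> Poly_Mapping.keys v"
    using keys_mult[of u v] by blast
  with uv n show "wdeg w = n" by (simp add: wdeg_plus)
qed

lemma homog_scal [simp]: "homog 0 (scal c)"
  by (simp add: homog_def scal_def zero_word_def)

lemma homog_gen: "homog (gdeg g) (gen_elt g)"
  by (simp add: homog_def gen_elt_def)

lemma homog_mon: "homog (wdeg (Word xs)) (mon xs)"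
  by (simp add: homog_def mon_def)

lemma homog_scal_mult: "homog d u \<Longrightarrow> homog d (scal c * u)"
  by (rule homog_mult[OF homog_scal]) auto

lemma homog_comm: "homog d u \<Longrightarrow> homog e v \<Longrightarrow> homog (d + e) (comm u v)"
  unfolding comm_def
  by (intro homog_diff homog_mult[of d u e v] homog_mult[of e v d u]) simp_all

lemma homog_comm_pow: "homog d u \<Longrightarrow> homog e v \<Longrightarrow> homog (of_nat n * d + e) ((comm u ^^ n) v)"
proof (induction n)
  case (Suc n)
  have "homog (d + (of_nat n * d + e)) (comm u ((comm u ^^ n) v))"
    using homog_comm Suc by blast
  moreover have "d + (of_nat n * d + e) = of_nat (Suc n) * d + e"
    by (simp add: algebra_simps)
  ultimately show ?case by simp
qed simp

definition proj :: "int \<Rightarrow> 'n falg \<Rightarrow> 'n falg" where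
  "proj d u = Poly_Mapping.mapp (\<lambda>w c. c when wdeg w = d) u"

lemma lookup_proj: "Poly_Mapping.lookup (proj d u) w = (Poly_Mapping.lookup u w when wdeg w = d)"
  by (auto simp: proj_def lookup_mapp when_def in_keys_iff)

lemma proj_0 [simp]: "proj d 0 = 0"
  by (intro poly_mapping_eqI) (simp add: lookup_proj)

lemma proj_add: "proj d (u + v) = proj d u + proj d v"
  by (intro poly_mapping_eqI) (simp add: lookup_proj lookup_add when_def)

lemma proj_diff: "proj d (u - v) = proj d u - proj d v"
  by (intro poly_mapping_eqI) (simp add: lookup_proj lookup_minus when_def)

lemma proj_homog: "homog e u \<Longrightarrow> proj d u = (if d = e then u else 0)"
  by (intro poly_mapping_eqI) (auto simp: lookup_proj when_def homog_def in_keys_iff)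

text \<open>By bilinearity \<open>a\<close> and \<open>b\<close> may be taken to be monomials; the
  product is then homogeneous, so \<open>proj\<close> keeps it or kills it. \<open>T\<close> is not
  assumed closed under scaling, hence the scalar in the second hypothesis.\<close>

lemma proj_mem_sandwich:
  assumes "homog d s" and "\<And>c xs ys. scal c * (mon xs * s * mon ys) \<in> T" and "0 \<in> T"
    and "\<And>x y. x \<in> T \<Longrightarrow> y \<in> T \<Longrightarrow> x + y \<in> T"
  shows "proj n (a * s * b) \<in> T"
proof (induction a rule: falg_induct)
  case (add xs c p)
  have "proj n (scal c * mon xs * s * b) \<in> T"
  proof (induction b rule: falg_induct)
    case (add ys e q)
    have "scal c * mon xs * s * (scal e * mon ys) = scal (c * e) * (mon xs * s * mon ys)"
      using scal_mult_both[of c "mon xs * s" e "mon ys"] by (simp only: mult.assoc)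
    moreover have "homog (wdeg (Word xs) + d + wdeg (Word ys)) (scal (c * e) * (mon xs * s * mon ys))"
      by (intro homog_scal_mult homog_mult[OF _ _ refl] homog_mon assms)
    ultimately have "proj n (scal c * mon xs * s * (scal e * mon ys)) \<in> T"
      using assms(2,3) by (simp only: proj_homog) simp
    then show ?case using add assms(4) by (simp add: distrib_left proj_add)
  qed (simp add: assms)
  then show ?case using add assms(4) by (simp add: distrib_right proj_add)
qed (simp add: assms)

lemma proj_mem_left:
  assumes "homog d s" and "\<And>c xs. scal c * (mon xs * s) \<in> T" and "0 \<in> T"
    and "\<And>x y. x \<in> T \<Longrightarrow> y \<in> T \<Longrightarrow> x + y \<in> T"
  shows "proj n (a * s) \<in> T"
proof (induction a rule: falg_induct)
  case (add xs c p)
  have "homog (wdeg (Word xs) + d) (scal c * (mon xs * s))"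
    by (intro homog_scal_mult homog_mult[OF _ _ refl] homog_mon assms)
  then have "proj n (scal c * (mon xs * s)) \<in> T"
    using assms(2,3) by (simp only: proj_homog) simp
  then show ?case using add assms(4) by (simp add: distrib_right proj_add mult.assoc)
qed (simp add: assms)

section \<open>The annihilator of the highest weight vector\<close>

lemma two_sided_ideal_add:
  assumes "y \<in> two_sided_ideal S" "x \<in> two_sided_ideal S"
  shows "x + y \<in> two_sided_ideal S"
  using assms by (induction y) (auto simp flip: add.assoc intro: two_sided_ideal.intros)

lemma two_sided_ideal_mult:
  assumes "x \<in> two_sided_ideal S"
  shows "a * x * b \<in> two_sided_ideal S"
  using assms
proof (induction x)
  case (add x s c d)
  have "a * (x + c * s * d) * b = a * x * b + (a * c) * s * (d * b)"
    by (simp add: algebra_simps)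
  then show ?case using two_sided_ideal.add[OF add(3,2)] by metis
qed (simp add: two_sided_ideal.zero)

lemma two_sided_ideal_base: "s \<in> S \<Longrightarrow> s \<in> two_sided_ideal S"
  using two_sided_ideal.add[OF two_sided_ideal.zero, of s S 1 1] by simp

lemma left_ideal_add:
  assumes "y \<in> left_ideal S" "x \<in> left_ideal S"
  shows "x + y \<in> left_ideal S"
  using assms by (induction y) (auto simp flip: add.assoc intro: left_ideal.intros)

lemma left_ideal_mult:
  assumes "x \<in> left_ideal S"
  shows "a * x \<in> left_ideal S"
  using assms
proof (induction x)
  case (add x s c)
  have "a * (x + c * s) = a * x + (a * c) * s"
    by (simp add: algebra_simps)
  then show ?case using left_ideal.add[OF add(3,2)] by metis
qed (simp add: left_ideal.zero)

lemma left_ideal_base: "s \<in> S \<Longrightarrow> s \<in> left_ideal S"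
  using left_ideal.add[OF left_ideal.zero, of s S 1] by simp

lemma relators_homog: "s \<in> relators G \<Longrightarrow> \<exists>d. homog d s"
proof (induction rule: relators.induct)
  case (hh i j)
  show ?case by (rule exI, rule homog_comm[OF homog_gen homog_gen])
next
  case (he i j)
  have "homog (-1) (comm (h_elt i) (e_elt j))" "homog (-1) (e_elt j)"
    using homog_comm[OF homog_gen homog_gen, of "Hgen i" "Egen j"] homog_gen[of "Egen j"] by simp_all
  then show ?case by (intro exI[of _ "-1"] homog_diff homog_scal_mult)
next
  case (hf i j)
  have "homog 1 (comm (h_elt i) (f_elt j))" "homog 1 (f_elt j)"
    using homog_comm[OF homog_gen homog_gen, of "Hgen i" "Fgen j"] homog_gen[of "Fgen j"] by simp_all
  then show ?case by (intro exI[of _ 1] homog_add homog_scal_mult)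
next
  case (ef i j)
  have "homog 0 (comm (e_elt i) (f_elt j))" "homog 0 (if i = j then h_elt j else 0)"
    using homog_comm[OF homog_gen homog_gen, of "Egen i" "Fgen j"] homog_gen[of "Hgen j"] by simp_all
  then show ?case by (intro exI[of _ 0] homog_diff)
next
  case (serre_e i j)
  show ?case by (rule exI, rule homog_comm_pow[OF homog_gen homog_gen])
next
  case (serre_f i j)
  show ?case by (rule exI, rule homog_comm_pow[OF homog_gen homog_gen])
qed

text \<open>An ideal generated by homogeneous elements is graded: relators of different degrees
  occur, but each single one is homogeneous.\<close>

lemma uea_ideal_proj:
  assumes "x \<in> uea_ideal G" shows "proj n x \<in> uea_ideal G"
  using assms unfolding uea_ideal_def
proof (induction x)
  case (add x s a b)
  obtain d where "homog d s" using relators_homog add(2) by blast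
  then have "proj n (a * s * b) \<in> two_sided_ideal (relators G)"
  proof (rule proj_mem_sandwich)
    fix c xs ys
    have "scal c * (mon xs * s * mon ys) = (scal c * mon xs) * s * mon ys" by (simp add: mult.assoc)
    then show "scal c * (mon xs * s * mon ys) \<in> two_sided_ideal (relators G)"
      by (simp only: two_sided_ideal_mult[OF two_sided_ideal_base[OF add(2)]])
  qed (rule two_sided_ideal.zero, rule two_sided_ideal_add)
  with add show ?case by (simp add: proj_add two_sided_ideal_add)
qed (simp add: two_sided_ideal.zero)

lemma relators_in_uea: "s \<in> relators G \<Longrightarrow> a * s * b \<in> uea_ideal G"
  unfolding uea_ideal_def by (intro two_sided_ideal_mult two_sided_ideal_base)

lemma uea_ideal_mult: "x \<in> uea_ideal G \<Longrightarrow> a * x * b \<in> uea_ideal G"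
  unfolding uea_ideal_def by (rule two_sided_ideal_mult)

lemma verma_ideal_0 [simp]: "0 \<in> verma_ideal G \<Lambda>"
  unfolding verma_ideal_def by (rule left_ideal.zero)

lemma verma_ideal_add: "x \<in> verma_ideal G \<Lambda> \<Longrightarrow> y \<in> verma_ideal G \<Lambda> \<Longrightarrow> x + y \<in> verma_ideal G \<Lambda>"
  unfolding verma_ideal_def by (rule left_ideal_add)

lemma verma_ideal_mult: "x \<in> verma_ideal G \<Lambda> \<Longrightarrow> a * x \<in> verma_ideal G \<Lambda>"
  unfolding verma_ideal_def by (rule left_ideal_mult)

lemma verma_ideal_minus: "x \<in> verma_ideal G \<Lambda> \<Longrightarrow> - x \<in> verma_ideal G \<Lambda>"
  using verma_ideal_mult[of x G \<Lambda> "-1"] by simp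

lemma verma_ideal_diff: "x \<in> verma_ideal G \<Lambda> \<Longrightarrow> y \<in> verma_ideal G \<Lambda> \<Longrightarrow> x - y \<in> verma_ideal G \<Lambda>"
  using verma_ideal_add[OF _ verma_ideal_minus] by fastforce

lemma verma_ideal_sum: "(\<And>i. i \<in> A \<Longrightarrow> f i \<in> verma_ideal G \<Lambda>) \<Longrightarrow> sum f A \<in> verma_ideal G \<Lambda>"
  by (induction A rule: infinite_finite_induct) (auto intro: verma_ideal_add)

lemma uea_in_verma: "x \<in> uea_ideal G \<Longrightarrow> x \<in> verma_ideal G \<Lambda>"
  unfolding verma_ideal_def by (simp add: left_ideal_base)

text \<open>The left ideal contains the two-sided ideal of relations. So a commutation relation may
  be applied in front of any word \<open>b\<close> and, together with
  \<open>verma_ideal_mult\<close>, at any position inside a word.\<close>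

lemma relators_in_verma: "s \<in> relators G \<Longrightarrow> s * b \<in> verma_ideal G \<Lambda>"
  using uea_in_verma relators_in_uea[of s G 1 b] by fastforce

lemma e_in_verma: "e_elt i \<in> verma_ideal G \<Lambda>"
  unfolding verma_ideal_def by (simp add: left_ideal_base)

lemma h_in_verma: "h_elt i - scal (form G \<Lambda> (coroot G i)) \<in> verma_ideal G \<Lambda>"
  unfolding verma_ideal_def by (simp add: left_ideal_base)

lemma verma_ideal_proj:
  assumes "x \<in> verma_ideal G \<Lambda>" shows "proj n x \<in> verma_ideal G \<Lambda>"
  using assms unfolding verma_ideal_def
proof (induction x)
  case (add x s a)
  note ih = add(3)[folded verma_ideal_def]
  let ?h = "\<lambda>i. h_elt i - scal (form G \<Lambda> (coroot G i))"
  have hom: "homog (-1) (e_elt i)" "homog 0 (?h i)" for i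
    using homog_gen[of "Egen i"] homog_diff[OF homog_gen[of "Hgen i"]] by simp_all
  have mon: "scal c * (mon xs * s) \<in> verma_ideal G \<Lambda>" for c xs
    using left_ideal_base[OF add(2)] by (intro verma_ideal_mult) (simp add: verma_ideal_def)
  have "proj n (a * s) \<in> verma_ideal G \<Lambda>"
  \<comment> \<open>Elements of \<open>uea_ideal\<close> need not be homogeneous and are treated
    through the gradedness of that ideal; the other generators are homogeneous of degree -1 or
    0.\<close>
  proof (cases "s \<in> uea_ideal G")
    case True
    then have "a * s \<in> uea_ideal G" using uea_ideal_mult[of s G a 1] by simp
    then show ?thesis by (intro uea_in_verma uea_ideal_proj)
  next
    case False
    then obtain d where "homog d s" using add(2) hom by auto
    then show ?thesis by (rule proj_mem_left[OF _ mon verma_ideal_0 verma_ideal_add])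
  qed
  from verma_ideal_add[OF ih this] show ?case
    by (simp only: proj_add verma_ideal_def)
qed (simp add: left_ideal.zero)

section \<open>Highest weight vectors and normal ordering\<close>

abbreviation fmon :: "'n option list \<Rightarrow> 'n falg" where
  "fmon is \<equiv> mon (map Fgen is)"

text \<open>The length is compared in the integers, so that lowering the degree needs no case
  distinction: for negative \<open>n\<close> only 0 is left, and this is the source of all vanishing
  statements below.\<close>

definition fspan :: "int \<Rightarrow> 'n falg set" where
  "fspan n = {u. Poly_Mapping.keys u \<subseteq> Word ` {map Fgen is |is. int (length is) = n}}"

lemma fspan_0 [simp]: "0 \<in> fspan n"
  by (simp add: fspan_def)

lemma fspan_add: "u \<in> fspan n \<Longrightarrow> v \<in> fspan n \<Longrightarrow> u + v \<in> fspan n"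
  unfolding fspan_def using keys_add[of u v] by auto

lemma fspan_scal_fmon: "int (length is) = n \<Longrightarrow> scal c * fmon is \<in> fspan n"
  by (auto simp: fspan_def simp flip: single_eq_scal_mon)

lemma fspan_fmon: "int (length is) = n \<Longrightarrow> fmon is \<in> fspan n"
  using fspan_scal_fmon[of "is" n 1] by simp

lemma fspan_induct [consumes 1, case_names zero add]:
  assumes "u \<in> fspan n" and "P 0"
    and "\<And>is c p. int (length is) = n \<Longrightarrow> p \<in> fspan n \<Longrightarrow> P p \<Longrightarrow> P (p + scal c * fmon is)"
  shows "P u"
proof -
  have "Poly_Mapping.keys u \<subseteq> Word ` {map Fgen is |is. int (length is) = n}"
    using assms(1) by (simp add: fspan_def)
  then have "u \<in> fspan n \<and> P u"
    by (induction u rule: falg_induct_on) (auto simp: assms intro: fspan_add fspan_scal_fmon)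
  then show ?thesis by simp
qed

lemma fspan_scal: "u \<in> fspan n \<Longrightarrow> scal c * u \<in> fspan n"
  by (induction u rule: fspan_induct)
    (auto simp: distrib_left scal_mult_left intro: fspan_add fspan_scal_fmon)

lemma fspan_f_mult: "u \<in> fspan n \<Longrightarrow> f_elt i * u \<in> fspan (n + 1)"
proof (induction u rule: fspan_induct)
  case (add js c p)
  have "scal c * (f_elt i * fmon js) \<in> fspan (n + 1)"
    using fspan_scal_fmon[of "i # js" "n + 1" c] add(1) by (simp add: mon_Cons)
  then show ?case using fspan_add[OF add(3)] by (simp add: distrib_left gen_scal)
qed simp

lemma homog_fspan: "u \<in> fspan n \<Longrightarrow> homog n u"
proof (induction u rule: fspan_induct)
  case (add js c p)
  have "wdeg (Word (map Fgen js)) = n"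
    using add(1) by (simp add: comp_def sum_list_triv)
  then show ?case using add(3) homog_mon[of "map Fgen js"] by (auto intro: homog_add homog_scal_mult)
qed simp

lemma fspan_neg: "u \<in> fspan n \<Longrightarrow> n < 0 \<Longrightarrow> u = 0"
  by (induction u rule: fspan_induct) auto

lemma fspan_zero_scal: "u \<in> fspan 0 \<Longrightarrow> \<exists>c. u = scal c"
proof (induction u rule: fspan_induct)
  case zero
  show ?case using scal_0 by metis
next
  case (add js c p)
  then show ?case by (auto simp flip: scal_add)
qed

text \<open>\<open>x\<close> represents a vector of the Verma module, possibly zero. It is kept
  general because it serves twice: \<open>x = 1\<close> gives normal ordering in the module itself,
  a singular vector gives control of the submodule that it generates.\<close>

definition highest_weight_vec ::
  "'n::finite affine_data \<Rightarrow> 'n weight \<Rightarrow> ('n option \<Rightarrow> complex) \<Rightarrow> 'n falg \<Rightarrow> bool" where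
  "highest_weight_vec G \<Lambda> c x \<longleftrightarrow>
     (\<forall>i. e_elt i * x \<in> verma_ideal G \<Lambda> \<and> h_elt i * x - scal (c i) * x \<in> verma_ideal G \<Lambda>)"

lemma highest_weight_vec_1: "highest_weight_vec G \<Lambda> (\<lambda>i. form G \<Lambda> (coroot G i)) 1"
  by (simp add: highest_weight_vec_def e_in_verma h_in_verma)

lemma hw_h_fmon:
  assumes "highest_weight_vec G \<Lambda> c x"
  shows "h_elt i * (fmon is * x) - scal (c i - (\<Sum>j\<leftarrow>is. of_int (cartan G j i))) * (fmon is * x)
    \<in> verma_ideal G \<Lambda>"
proof (induction "is")
  case Nil
  then show ?case using assms by (simp add: highest_weight_vec_def)
next
  case (Cons j js)
  let ?s = "c i - (\<Sum>j\<leftarrow>js. of_int (cartan G j i))" and ?y = "fmon js * x"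
  let ?R = "comm (h_elt i) (f_elt j) + scal (of_int (cartan G j i)) * f_elt j"
  \<comment> \<open>The relator replaces h f by f h and a multiple of f; the left multiple of the
    induction hypothesis then evaluates h on the shorter word.\<close>
  have "?R * ?y + f_elt j * (h_elt i * ?y - scal ?s * ?y) \<in> verma_ideal G \<Lambda>"
    by (intro verma_ideal_add verma_ideal_mult relators_in_verma relators.hf Cons)
  also have "?R * ?y + f_elt j * (h_elt i * ?y - scal ?s * ?y) =
    h_elt i * (f_elt j * ?y) - scal (?s - of_int (cartan G j i)) * (f_elt j * ?y)"
    unfolding scal_diff[of ?s] by (simp add: comm_def algebra_simps gen_scal)
  finally show ?case by (simp add: mon_Cons mult.assoc algebra_simps)
qed

text \<open>On its way to the right e_i either reaches \<open>x\<close> and dies or meets a letter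
  f_i and becomes h_i, which is a scalar on the rest of the word. Each surviving term has lost
  exactly one letter; for the empty word the degree is -1 and \<open>z = 0\<close>.\<close>

lemma hw_e_fmon:
  assumes "highest_weight_vec G \<Lambda> c x"
  shows "\<exists>z\<in>fspan (int (length is) - 1). e_elt i * (fmon is * x) - z * x \<in> verma_ideal G \<Lambda>"
proof (induction "is")
  case Nil
  then show ?case using assms by (auto simp: highest_weight_vec_def intro!: bexI[of _ 0])
next
  case (Cons j js)
  let ?s = "c j - (\<Sum>k\<leftarrow>js. of_int (cartan G k j))" and ?y = "fmon js * x"
  obtain z where z: "z \<in> fspan (int (length js) - 1)" "e_elt i * ?y - z * x \<in> verma_ideal G \<Lambda>"
    using Cons by blast
  let ?R = "comm (e_elt i) (f_elt j) - (if i = j then h_elt j else 0)"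
  let ?z = "(if i = j then scal ?s * fmon js else 0) + f_elt j * z"
  have "(if i = j then h_elt j * ?y - scal ?s * ?y else 0) \<in> verma_ideal G \<Lambda>"
    using hw_h_fmon[OF assms] by simp
  then have "?R * ?y + (if i = j then h_elt j * ?y - scal ?s * ?y else 0) + f_elt j * (e_elt i * ?y - z * x)
      \<in> verma_ideal G \<Lambda>"
    by (intro verma_ideal_add verma_ideal_mult relators_in_verma relators.ef z)
  also have "?R * ?y + (if i = j then h_elt j * ?y - scal ?s * ?y else 0) + f_elt j * (e_elt i * ?y - z * x)
    = e_elt i * (f_elt j * ?y) - ?z * x"
    by (auto simp: comm_def algebra_simps)
  finally have "e_elt i * (fmon (j # js) * x) - ?z * x \<in> verma_ideal G \<Lambda>"
    by (simp add: mon_Cons mult.assoc)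
  moreover have "?z \<in> fspan (int (length (j # js)) - 1)"
    using fspan_f_mult[OF z(1)] by (intro fspan_add) (auto intro: fspan_scal_fmon)
  ultimately show ?case by blast
qed

lemma hw_gen_fspan:
  assumes "highest_weight_vec G \<Lambda> c x" and "z \<in> fspan n"
  shows "\<exists>z'\<in>fspan (n + gdeg g). gen_elt g * (z * x) - z' * x \<in> verma_ideal G \<Lambda>"
  using assms(2)
proof (induction z rule: fspan_induct)
  case zero
  then show ?case by (auto intro!: bexI[of _ 0])
next
  case (add js a p)
  obtain z' where z': "z' \<in> fspan (n + gdeg g)" "gen_elt g * (p * x) - z' * x \<in> verma_ideal G \<Lambda>"
    using add by blast
  have "\<exists>u\<in>fspan (n + gdeg g). gen_elt g * (fmon js * x) - u * x \<in> verma_ideal G \<Lambda>"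
  proof (cases g)
    case (Egen i)
    then show ?thesis using hw_e_fmon[OF assms(1), of js i] add(1) by auto
  next
    case (Fgen i)
    then show ?thesis using fspan_f_mult[OF fspan_fmon[OF add(1)], of i]
      by (auto intro!: bexI[of _ "f_elt i * fmon js"] simp: mult.assoc)
  next
    case (Hgen i)
    have "scal (c i - (\<Sum>j\<leftarrow>js. of_int (cartan G j i))) * fmon js \<in> fspan (n + gdeg g)"
      using Hgen add(1) by (auto intro: fspan_scal_fmon)
    moreover have "h_elt i * (fmon js * x) -
        (scal (c i - (\<Sum>j\<leftarrow>js. of_int (cartan G j i))) * fmon js) * x \<in> verma_ideal G \<Lambda>"
      using hw_h_fmon[OF assms(1), of i js] by (simp only: mult.assoc)
    ultimately show ?thesis using Hgen by blast
  qed
  then obtain u where u: "u \<in> fspan (n + gdeg g)"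
    "gen_elt g * (fmon js * x) - u * x \<in> verma_ideal G \<Lambda>" by blast
  have "(gen_elt g * (p * x) - z' * x) + scal a * (gen_elt g * (fmon js * x) - u * x) \<in> verma_ideal G \<Lambda>"
    by (intro verma_ideal_add verma_ideal_mult z' u)
  also have "(gen_elt g * (p * x) - z' * x) + scal a * (gen_elt g * (fmon js * x) - u * x) =
    gen_elt g * ((p + scal a * fmon js) * x) - (z' + scal a * u) * x"
    by (simp add: algebra_simps gen_scal)
  finally show ?case using fspan_add[OF z'(1) fspan_scal[OF u(1)]] by blast
qed

text \<open>The letters of \<open>a\<close> are absorbed one by one from the right, each shifting
  the degree of the f-words by its own. This is the spanning half of the triangular decomposition,
  relative to \<open>x\<close>; for \<open>d < 0\<close> it says that \<open>a\<close> kills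
  \<open>x\<close>.\<close>

lemma hw_homog:
  assumes "highest_weight_vec G \<Lambda> c x" and "homog d a"
  shows "\<exists>z\<in>fspan d. a * x - z * x \<in> verma_ideal G \<Lambda>"
proof -
  have w: "\<exists>z\<in>fspan (wdeg (Word xs)). mon xs * x - z * x \<in> verma_ideal G \<Lambda>" for xs
  proof (induction xs)
    case Nil
    have "fmon [] \<in> fspan (0 :: int)" by (rule fspan_fmon) simp
    then show ?case by (auto intro!: bexI[of _ 1])
  next
    case (Cons g xs)
    then obtain z where z: "z \<in> fspan (wdeg (Word xs))" "mon xs * x - z * x \<in> verma_ideal G \<Lambda>"
      by blast
    obtain z' where z': "z' \<in> fspan (wdeg (Word xs) + gdeg g)"
      "gen_elt g * (z * x) - z' * x \<in> verma_ideal G \<Lambda>"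
      using hw_gen_fspan[OF assms(1) z(1)] by blast
    have "gen_elt g * (mon xs * x - z * x) + (gen_elt g * (z * x) - z' * x) \<in> verma_ideal G \<Lambda>"
      by (intro verma_ideal_add verma_ideal_mult z z')
    then have "mon (g # xs) * x - z' * x \<in> verma_ideal G \<Lambda>"
      by (simp add: algebra_simps mon_Cons)
    then show ?case using z'(1) by (auto simp: add.commute)
  qed
  have "Poly_Mapping.keys a \<subseteq> Word ` {xs. wdeg (Word xs) = d}"
  proof
    fix w assume "w \<in> Poly_Mapping.keys a"
    then show "w \<in> Word ` {xs. wdeg (Word xs) = d}"
      using assms(2) by (cases w) (auto simp: homog_def)
  qed
  then show ?thesis
  proof (induction a rule: falg_induct_on)
    case zero
    then show ?case by (auto intro!: bexI[of _ 0])
  next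
    case (add xs s p)
    then obtain z u where z: "z \<in> fspan d" "p * x - z * x \<in> verma_ideal G \<Lambda>"
      and u: "u \<in> fspan d" "mon xs * x - u * x \<in> verma_ideal G \<Lambda>"
      using w[of xs] by auto
    have "(p * x - z * x) + scal s * (mon xs * x - u * x) \<in> verma_ideal G \<Lambda>"
      by (intro verma_ideal_add verma_ideal_mult z u)
    also have "(p * x - z * x) + scal s * (mon xs * x - u * x) =
      (p + scal s * mon xs) * x - (z + scal s * u) * x"
      by (simp add: algebra_simps)
    finally show ?case using fspan_add[OF z(1) fspan_scal[OF u(1)]] by blast
  qed
qed

lemma normal_order:
  assumes "homog d a"
  obtains z where "z \<in> fspan d" "a - z \<in> verma_ideal G \<Lambda>"
  using hw_homog[OF highest_weight_vec_1 assms, of G \<Lambda>] by auto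

lemma homog_neg_in_verma: "homog d a \<Longrightarrow> d < 0 \<Longrightarrow> a \<in> verma_ideal G \<Lambda>"
  by (metis normal_order fspan_neg diff_zero)

section \<open>Cosets and irreducibility\<close>

lemma verma_vec_eq_iff: "verma_vec G \<Lambda> u = verma_vec G \<Lambda> v \<longleftrightarrow> u - v \<in> verma_ideal G \<Lambda>"
proof
  assume "verma_vec G \<Lambda> u = verma_vec G \<Lambda> v"
  moreover have "u + 0 \<in> verma_vec G \<Lambda> u" unfolding verma_vec_def using verma_ideal_0 by blast
  ultimately show "u - v \<in> verma_ideal G \<Lambda>" by (auto simp: verma_vec_def)
next
  assume uv: "u - v \<in> verma_ideal G \<Lambda>"
  have "u + j = v + ((u - v) + j)" "v + j = u + (j - (u - v))" for j by simp_all
  then show "verma_vec G \<Lambda> u = verma_vec G \<Lambda> v"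
    unfolding verma_vec_def using verma_ideal_add[OF uv] verma_ideal_diff[OF _ uv] by blast
qed

lemma verma_act_vec: "verma_act G \<Lambda> a (verma_vec G \<Lambda> u) = verma_vec G \<Lambda> (a * u)"
proof -
  have "\<exists>k. a * (u + i) + j = a * u + k \<and> k \<in> verma_ideal G \<Lambda>"
    if "i \<in> verma_ideal G \<Lambda>" "j \<in> verma_ideal G \<Lambda>" for i j
    using that verma_ideal_add[OF verma_ideal_mult[of i G \<Lambda> a]]
    by (intro exI[of _ "a * i + j"]) (simp add: algebra_simps)
  moreover have "\<exists>x j'. a * u + j = a * x + j' \<and> (\<exists>i. x = u + i \<and> i \<in> verma_ideal G \<Lambda>) \<and> j' \<in> verma_ideal G \<Lambda>"
    if "j \<in> verma_ideal G \<Lambda>" for j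
    using that by (intro exI[of _ u] exI[of _ j]) auto
  ultimately show ?thesis unfolding verma_act_def verma_vec_def by (simp only: set_eq_iff mem_Collect_eq) blast
qed

text \<open>If 1 were in the ideal, all cosets would coincide, against the nonvanishing of the space
  that is part of \<open>verma_irreducible\<close>. The vacuum expectation rests on this
  fact.\<close>

lemma irreducible_nonzero:
  assumes "verma_irreducible G \<Lambda>" shows "1 \<notin> verma_ideal G \<Lambda>"
proof
  assume "1 \<in> verma_ideal G \<Lambda>"
  then have "u \<in> verma_ideal G \<Lambda>" for u using verma_ideal_mult[of 1 G \<Lambda> u] by simp
  then have "verma_vec G \<Lambda> u = verma_vec G \<Lambda> 0" for u by (simp add: verma_vec_eq_iff)
  then have "verma_space G \<Lambda> = {verma_vec G \<Lambda> 0}" by (auto simp: verma_space_def)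
  with assms show False by (simp add: verma_irreducible_def)
qed

text \<open>The submodule generated by \<open>x\<close> sits in degrees at least
  \<open>n > 0\<close>, so it does not contain the vacuum, and irreducibility makes it zero.\<close>

lemma hw_in_verma_ideal:
  assumes irr: "verma_irreducible G \<Lambda>" and hw: "highest_weight_vec G \<Lambda> c x"
    and x: "homog n x" "n > 0"
  shows "x \<in> verma_ideal G \<Lambda>"
proof -
  let ?N = "Set.range (\<lambda>a. verma_vec G \<Lambda> (a * x))"
  have "verma_submodule G \<Lambda> ?N"
    unfolding verma_submodule_def
  proof (intro conjI allI impI ballI)
    show "?N \<subseteq> verma_space G \<Lambda>" by (auto simp: verma_space_def)
    show "verma_vec G \<Lambda> 0 \<in> ?N" by (intro image_eqI[of _ _ 0]) auto
  next
    fix u v assume "verma_vec G \<Lambda> u \<in> ?N \<and> verma_vec G \<Lambda> v \<in> ?N"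
    then obtain a b where "u - a * x \<in> verma_ideal G \<Lambda>" "v - b * x \<in> verma_ideal G \<Lambda>"
      by (auto simp: verma_vec_eq_iff)
    from verma_ideal_add[OF this] have "verma_vec G \<Lambda> (u + v) = verma_vec G \<Lambda> ((a + b) * x)"
      by (simp add: verma_vec_eq_iff algebra_simps)
    then show "verma_vec G \<Lambda> (u + v) \<in> ?N" by blast
  next
    fix a X assume "X \<in> ?N"
    then obtain b where "X = verma_vec G \<Lambda> (b * x)" by blast
    then have "verma_act G \<Lambda> a X = verma_vec G \<Lambda> ((a * b) * x)"
      by (simp add: verma_act_vec mult.assoc)
    then show "verma_act G \<Lambda> a X \<in> ?N" by blast
  qed
  then consider "?N = {verma_vec G \<Lambda> 0}" | "?N = verma_space G \<Lambda>"
    using irr by (auto simp: verma_irreducible_def)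
  then show ?thesis
  proof cases
    case 1
    then have "verma_vec G \<Lambda> (1 * x) = verma_vec G \<Lambda> 0" by blast
    then show ?thesis by (simp add: verma_vec_eq_iff)
  next
    case 2
    then obtain a where a: "1 - a * x \<in> verma_ideal G \<Lambda>"
      unfolding verma_space_def by (metis (no_types, lifting) imageE rangeI verma_vec_eq_iff)
    \<comment> \<open>Only the part of \<open>a\<close> of degree \<open>- n\<close> lands in degree
      0, and it kills \<open>x\<close>, because normal ordering would leave f-words of negative
      length.\<close>
    have "proj 0 (a * x) \<in> verma_ideal G \<Lambda>"
    proof (induction a rule: falg_induct)
      case (add xs s p)
      let ?d = "wdeg (Word xs)"
      have "proj 0 (scal s * (mon xs * x)) \<in> verma_ideal G \<Lambda>"
      proof (cases "?d + n = 0")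
        case True
        then obtain z where "z \<in> fspan ?d" "mon xs * x - z * x \<in> verma_ideal G \<Lambda>"
          using hw_homog[OF hw homog_mon] by blast
        then have "mon xs * x \<in> verma_ideal G \<Lambda>" using fspan_neg[of z ?d] True x(2) by simp
        then show ?thesis by (intro verma_ideal_proj) (rule verma_ideal_mult)
      next
        case False
        have "homog (?d + n) (scal s * (mon xs * x))"
          by (intro homog_scal_mult homog_mult[OF homog_mon x(1) refl])
        from proj_homog[OF this, of 0] show ?thesis using False by simp
      qed
      then show ?case using add
        by (simp add: distrib_right proj_add mult.assoc verma_ideal_add)
    qed simp
    moreover have "proj 0 (1 :: 'a falg) = 1"
      using proj_homog[OF homog_scal[of 1], of 0] by simp
    \<comment> \<open>The degree-0 part of \<open>1 - a * x\<close> differs from 1 by an element of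
      the ideal.\<close>
    ultimately have "1 \<in> verma_ideal G \<Lambda>"
      using verma_ideal_add[OF verma_ideal_proj[OF a, of 0]] by (fastforce simp: proj_diff)
    then show ?thesis using irreducible_nonzero[OF irr] by simp
  qed
qed

section \<open>The Chevalley anti-involution\<close>

fun gswap :: "'i gen \<Rightarrow> 'i gen" where
  "gswap (Egen i) = Fgen i" | "gswap (Fgen i) = Egen i" | "gswap (Hgen i) = Hgen i"

lemma gswap_gswap [simp]: "gswap (gswap g) = g"
  by (cases g) simp_all

fun wswap :: "'i gen word \<Rightarrow> 'i gen word" where
  "wswap (Word xs) = Word (rev (map gswap xs))"

lemma wswap_wswap [simp]: "wswap (wswap w) = w"
  by (cases w) (simp add: rev_map comp_def)

lemma inj_wswap: "inj wswap"
  by (metis injI wswap_wswap)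

text \<open>\<open>map_key\<close> pulls coefficients back along \<open>wswap\<close>; since
  \<open>wswap\<close> is its own inverse, this is at the same time the linear extension of
  \<open>wswap\<close>.\<close>

definition anti :: "'n falg \<Rightarrow> 'n falg" where
  "anti = Poly_Mapping.map_key wswap"

lemma anti_add: "anti (u + v) = anti u + anti v"
  by (simp add: anti_def map_key_plus inj_wswap)

lemma anti_0 [simp]: "anti 0 = 0"
  by (simp add: anti_def inj_wswap)

lemma anti_minus: "anti (- u) = - anti u"
  using anti_add[of u "- u"] by (simp add: eq_neg_iff_add_eq_0 add.commute)

lemma anti_diff: "anti (u - v) = anti u - anti v"
  using anti_add[of u "- v"] by (simp add: anti_minus)

lemma anti_single: "anti (Poly_Mapping.single w c) = Poly_Mapping.single (wswap w) c"
  using map_key_single[OF inj_wswap, of "wswap w" c] by (simp add: anti_def)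

lemma anti_gen: "anti (gen_elt g) = gen_elt (gswap g)"
  by (simp add: gen_elt_def anti_single)

lemma anti_scal [simp]: "anti (scal c) = scal c"
  by (simp add: scal_def anti_single zero_word_def)

lemma anti_1 [simp]: "anti 1 = 1"
  using anti_scal[of 1] by simp

lemma wswap_plus: "wswap (v + w) = wswap w + wswap v"
  by (cases v; cases w) simp

lemma anti_mult: "anti (u * v) = anti v * anti u"
proof (induction u rule: poly_mapping_induct_single)
  case (add k c p)
  have "anti (Poly_Mapping.single k c * v) = anti v * anti (Poly_Mapping.single k c)"
    by (induction v rule: poly_mapping_induct_single)
      (simp_all add: distrib_left distrib_right anti_add anti_single mult_single wswap_plus mult.commute)
  with add show ?case by (simp add: distrib_left distrib_right anti_add)
qed simp

lemma anti_anti [simp]: "anti (anti u) = u"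
  by (induction u rule: poly_mapping_induct_single) (simp_all add: anti_add anti_single)

lemma anti_comm: "anti (comm u v) = comm (anti v) (anti u)"
  by (simp add: comm_def anti_diff anti_mult)

lemma comm_minus: "comm u (- v) = - comm u v" and comm_flip: "comm v u = - comm u v"
  by (simp_all add: comm_def)

text \<open>Each bracket is reversed and contributes a sign. The total sign is left open, since
  membership in an ideal does not see it.\<close>

lemma anti_comm_pow:
  "anti ((comm u ^^ n) v) = (comm (anti u) ^^ n) (anti v) \<or>
   anti ((comm u ^^ n) v) = - (comm (anti u) ^^ n) (anti v)"
proof (induction n)
  case (Suc n)
  then show ?case
    by (auto simp: anti_comm comm_flip[of _ "anti u"] comm_minus)
qed simp

text \<open>The relators \<open>he\<close> and \<open>hf\<close>, and the two Serre families, are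
  exchanged up to sign; \<open>hh\<close> and \<open>ef\<close> go to themselves with the two
  indices swapped.\<close>

lemma anti_relator:
  assumes "s \<in> relators G" shows "anti s \<in> relators G \<or> - anti s \<in> relators G"
  using assms
proof cases
  case (hh i j)
  then show ?thesis using relators.hh[of j i G] by (simp add: anti_comm anti_gen)
next
  case (he i j)
  have "- anti s = comm (h_elt i) (f_elt j) + scal (of_int (cartan G j i)) * f_elt j"
    by (simp add: he anti_comm anti_gen anti_diff anti_mult comm_flip[of _ "h_elt i"] scal_commute)
  then show ?thesis using relators.hf[of i j G] by simp
next
  case (hf i j)
  have "- anti s = comm (h_elt i) (e_elt j) - scal (of_int (cartan G j i)) * e_elt j"
    by (simp add: hf anti_comm anti_gen anti_add anti_mult comm_flip[of _ "h_elt i"] scal_commute)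
  then show ?thesis using relators.he[of i j G] by simp
next
  case (ef i j)
  then show ?thesis using relators.ef[of j i G] by (auto simp: anti_comm anti_gen anti_diff)
next
  case (serre_e i j)
  then show ?thesis using relators.serre_f[of i j G]
      anti_comm_pow[where u = "e_elt i" and v = "e_elt j" and n = "nat (1 - cartan G j i)"]
    by (auto simp: anti_gen)
next
  case (serre_f i j)
  then show ?thesis using relators.serre_e[of i j G]
      anti_comm_pow[where u = "f_elt i" and v = "f_elt j" and n = "nat (1 - cartan G j i)"]
    by (auto simp: anti_gen)
qed

lemma anti_uea:
  assumes "x \<in> uea_ideal G" shows "anti x \<in> uea_ideal G"
  using assms unfolding uea_ideal_def
proof (induction x)
  case (add x s a b)
  have eq: "anti (x + a * s * b) = anti x + anti b * anti s * anti a"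
    "anti (x + a * s * b) = anti x + (- anti b) * (- anti s) * anti a"
    by (simp_all add: anti_add anti_mult mult.assoc)
  from anti_relator[OF add(2)] show ?case
  proof
    assume "anti s \<in> relators G"
    from two_sided_ideal.add[OF add(3) this] show ?thesis unfolding eq(1) .
  next
    assume "- anti s \<in> relators G"
    from two_sided_ideal.add[OF add(3) this] show ?thesis unfolding eq(2) .
  qed
qed (simp add: two_sided_ideal.zero)

lemma anti_verma_dual:
  assumes "x \<in> verma_ideal G \<Lambda>" shows "anti x \<in> dual_ideal G \<Lambda>"
  using assms unfolding verma_ideal_def dual_ideal_def
proof (induction x)
  case (add x s a)
  have eq: "anti (x + a * s) = anti x + anti s * anti a"
    by (simp add: anti_add anti_mult)
  have "anti s \<in> uea_ideal G \<union> range f_elt \<union> range (\<lambda>i. h_elt i - scal (form G \<Lambda> (coroot G i)))"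
    using add(2) by (auto simp: anti_uea anti_gen anti_diff)
  from right_ideal.add[OF add(3) this] show ?case unfolding eq .
qed (simp add: right_ideal.zero)

lemma anti_dual_verma:
  assumes "x \<in> dual_ideal G \<Lambda>" shows "anti x \<in> verma_ideal G \<Lambda>"
  using assms unfolding verma_ideal_def dual_ideal_def
proof (induction x)
  case (add x s a)
  have eq: "anti (x + s * a) = anti x + anti a * anti s"
    by (simp add: anti_add anti_mult)
  have "anti s \<in> uea_ideal G \<union> range e_elt \<union> range (\<lambda>i. h_elt i - scal (form G \<Lambda> (coroot G i)))"
    using add(2) by (auto simp: anti_uea anti_gen anti_diff)
  from left_ideal.add[OF add(3) this] show ?case unfolding eq .
qed (simp add: left_ideal.zero)

text \<open>This equivalence carries closure properties and computations from the Verma module over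
  to the right module.\<close>

lemma dual_ideal_iff: "x \<in> dual_ideal G \<Lambda> \<longleftrightarrow> anti x \<in> verma_ideal G \<Lambda>"
  using anti_verma_dual[of "anti x" G \<Lambda>] anti_dual_verma[of x G \<Lambda>] by auto

lemma dual_ideal_0 [simp]: "0 \<in> dual_ideal G \<Lambda>"
  by (simp add: dual_ideal_iff)

lemma dual_ideal_add: "x \<in> dual_ideal G \<Lambda> \<Longrightarrow> y \<in> dual_ideal G \<Lambda> \<Longrightarrow> x + y \<in> dual_ideal G \<Lambda>"
  by (simp add: dual_ideal_iff anti_add verma_ideal_add)

lemma dual_ideal_diff: "x \<in> dual_ideal G \<Lambda> \<Longrightarrow> y \<in> dual_ideal G \<Lambda> \<Longrightarrow> x - y \<in> dual_ideal G \<Lambda>"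
  by (simp add: dual_ideal_iff anti_diff verma_ideal_diff)

lemma dual_ideal_mult: "x \<in> dual_ideal G \<Lambda> \<Longrightarrow> x * a \<in> dual_ideal G \<Lambda>"
  by (simp add: dual_ideal_iff anti_mult verma_ideal_mult)

lemma dual_vec_eq_iff: "dual_vec G \<Lambda> u = dual_vec G \<Lambda> v \<longleftrightarrow> u - v \<in> dual_ideal G \<Lambda>"
proof
  assume "dual_vec G \<Lambda> u = dual_vec G \<Lambda> v"
  moreover have "u + 0 \<in> dual_vec G \<Lambda> u" unfolding dual_vec_def using dual_ideal_0 by blast
  ultimately show "u - v \<in> dual_ideal G \<Lambda>" by (auto simp: dual_vec_def)
next
  assume uv: "u - v \<in> dual_ideal G \<Lambda>"
  have "u + j = v + ((u - v) + j)" "v + j = u + (j - (u - v))" for j by simp_all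
  then show "dual_vec G \<Lambda> u = dual_vec G \<Lambda> v"
    unfolding dual_vec_def using dual_ideal_add[OF uv] dual_ideal_diff[OF _ uv] by blast
qed

lemma dual_act_vec: "dual_act G \<Lambda> (dual_vec G \<Lambda> u) a = dual_vec G \<Lambda> (u * a)"
proof -
  have "\<exists>k. (u + i) * a + j = u * a + k \<and> k \<in> dual_ideal G \<Lambda>"
    if "i \<in> dual_ideal G \<Lambda>" "j \<in> dual_ideal G \<Lambda>" for i j
    using that dual_ideal_add[OF dual_ideal_mult[of i G \<Lambda> a]]
    by (intro exI[of _ "i * a + j"]) (simp add: algebra_simps)
  moreover have "\<exists>x j'. u * a + j = x * a + j' \<and> (\<exists>i. x = u + i \<and> i \<in> dual_ideal G \<Lambda>) \<and> j' \<in> dual_ideal G \<Lambda>"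
    if "j \<in> dual_ideal G \<Lambda>" for j
    using that by (intro exI[of _ u] exI[of _ j]) auto
  ultimately show ?thesis unfolding dual_act_def dual_vec_def by (simp only: set_eq_iff mem_Collect_eq) blast
qed

section \<open>The vacuum expectation value\<close>

text \<open>Consider a product \<open>s * a\<close> of total degree 0. If \<open>s\<close> is some
  f_i, then \<open>a\<close> has negative degree and kills the vacuum. If \<open>s\<close> is a
  shifted h_i, then \<open>a\<close> has degree 0 and acts on the vacuum by a scalar, after which
  \<open>s\<close> kills the vacuum because both vacua have the same weight. The relations
  themselves lie in both ideals.\<close>

lemma dual_ideal_proj_0:
  assumes "x \<in> dual_ideal G \<Lambda>" shows "proj 0 x \<in> verma_ideal G \<Lambda>"
  using assms unfolding dual_ideal_def
proof (induction x)
  case (add x s a)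
  let ?h = "\<lambda>i. h_elt i - scal (form G \<Lambda> (coroot G i))"
  have hom: "homog 1 (f_elt i)" "homog 0 (?h i)" for i
    using homog_gen[of "Fgen i"] homog_diff[OF homog_gen[of "Hgen i"]] by simp_all
  have "proj 0 (s * a) \<in> verma_ideal G \<Lambda>"
  proof (cases "s \<in> uea_ideal G")
    case True
    then have "s * a \<in> uea_ideal G" using uea_ideal_mult[of s G 1 a] by simp
    then show ?thesis by (intro uea_in_verma uea_ideal_proj)
  next
    case False
    show ?thesis
    proof (induction a rule: falg_induct)
      case (add xs c p)
      let ?m = "scal c * mon xs" and ?d = "wdeg (Word xs)"
      have m: "homog ?d ?m" by (intro homog_scal_mult homog_mon)
      have "proj 0 (s * ?m) \<in> verma_ideal G \<Lambda>"
      proof -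
        consider i where "s = f_elt i" | i where "s = ?h i"
          using False \<open>s \<in> _\<close> by blast
        then show ?thesis
        proof cases
          case 1
          have "homog (1 + ?d) (s * ?m)" using homog_mult[OF hom(1) m refl] 1 by simp
          from proj_homog[OF this, of 0] have p: "proj 0 (s * ?m) = (if 1 + ?d = 0 then s * ?m else 0)"
            by auto
          have "?d < 0 \<Longrightarrow> ?m \<in> verma_ideal G \<Lambda>"
            by (rule homog_neg_in_verma[OF m])
          then show ?thesis unfolding p using verma_ideal_mult[of ?m G \<Lambda> s] by auto
        next
          case 2
          have "homog (0 + ?d) (s * ?m)" using homog_mult[OF hom(2) m refl] 2 by simp
          from proj_homog[OF this, of 0] have p: "proj 0 (s * ?m) = (if ?d = 0 then s * ?m else 0)"
            by auto
          show ?thesis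
          proof (cases "?d = 0")
            case True
            then obtain z where z: "z \<in> fspan 0" "?m - z \<in> verma_ideal G \<Lambda>"
              using normal_order[OF m] by metis
            then obtain e where e: "z = scal e" using fspan_zero_scal by blast
            \<comment> \<open>Since \<open>z\<close> is a scalar, it commutes with \<open>s\<close>,
              and the sum collapses to \<open>s * ?m\<close>.\<close>
            have "s * (?m - z) + z * s \<in> verma_ideal G \<Lambda>"
              unfolding 2 by (intro verma_ideal_add verma_ideal_mult z h_in_verma)
            moreover have "z * s = s * z" by (simp add: e scal_commute)
            ultimately show ?thesis unfolding p by (simp add: right_diff_distrib)
          qed (simp add: p)
        qed
      qed
      then show ?case using add by (simp add: distrib_left proj_add verma_ideal_add)
    qed simp
  qed
  then show ?case using add(3) by (simp add: proj_add verma_ideal_add)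
qed simp

text \<open>Normal ordering leaves f-words modulo the Verma ideal. A nonempty one starts with some
  f_j and so lies in the dual ideal; the empty one is the scalar.\<close>

lemma vacuum_decomposition: "\<exists>c. \<exists>l\<in>dual_ideal G \<Lambda>. \<exists>r\<in>verma_ideal G \<Lambda>. u = scal c + l + r"
proof (induction u rule: falg_induct)
  case zero
  have "(0 :: 'a falg) = scal 0 + 0 + 0" by simp
  then show ?case using dual_ideal_0 verma_ideal_0 by blast
next
  case (add xs s p)
  then obtain c l r where p: "p = scal c + l + r" "l \<in> dual_ideal G \<Lambda>" "r \<in> verma_ideal G \<Lambda>" by blast
  obtain z where z: "z \<in> fspan (wdeg (Word xs))" "scal s * mon xs - z \<in> verma_ideal G \<Lambda>"
    by (rule normal_order[OF homog_scal_mult[OF homog_mon]])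
  from z(1) have "\<exists>d. z - scal d \<in> dual_ideal G \<Lambda>"
  proof (induction z rule: fspan_induct)
    case zero
    show ?case by (intro exI[of _ 0]) simp
  next
    case (add js a q)
    then obtain d where d: "q - scal d \<in> dual_ideal G \<Lambda>" by blast
    show ?case
    proof (cases js)
      case Nil
      then show ?thesis using d by (intro exI[of _ "d + a"]) (simp add: scal_add)
    next
      case (Cons j ks)
      have "f_elt j \<in> dual_ideal G \<Lambda>" by (simp add: dual_ideal_iff anti_gen e_in_verma)
      then have "q - scal d + f_elt j * (scal a * fmon ks) \<in> dual_ideal G \<Lambda>"
        by (intro dual_ideal_add d) (rule dual_ideal_mult)
      then show ?thesis using Cons by (intro exI[of _ d]) (simp add: mon_Cons gen_scal algebra_simps)
    qed
  qed
  then obtain d where d: "z - scal d \<in> dual_ideal G \<Lambda>" by blast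
  have "p + scal s * mon xs = scal (c + d) + (l + (z - scal d)) + (r + (scal s * mon xs - z))"
    by (simp add: p scal_add)
  then show ?case using dual_ideal_add[OF p(2) d] verma_ideal_add[OF p(3) z(2)] by blast
qed

context
  fixes G :: "'n::finite affine_data" and \<Lambda> :: "'n weight"
  assumes nontrivial: "1 \<notin> verma_ideal G \<Lambda>"
begin

text \<open>The element \<open>scal (c - d)\<close> is its own degree-0 part, and elements of either
  ideal have their degree-0 parts in the Verma ideal; dividing by \<open>c - d\<close> would put 1
  there.\<close>

lemma vacuum_unique:
  assumes "scal c + l + r = scal d + m + s" "l \<in> dual_ideal G \<Lambda>" "m \<in> dual_ideal G \<Lambda>"
    "r \<in> verma_ideal G \<Lambda>" "s \<in> verma_ideal G \<Lambda>"
  shows "c = d"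
proof (rule ccontr)
  assume "c \<noteq> d"
  have "scal (c - d) = (m - l) + (s - r)" using assms(1) by (simp add: scal_diff algebra_simps)
  moreover have "proj 0 ((m - l) + (s - r)) \<in> verma_ideal G \<Lambda>"
    unfolding proj_add by (intro verma_ideal_add dual_ideal_proj_0 verma_ideal_proj
        dual_ideal_diff verma_ideal_diff assms)
  moreover have "proj 0 (scal (c - d)) = scal (c - d)"
    using proj_homog[OF homog_scal, of 0] by simp
  ultimately have "scal (c - d) \<in> verma_ideal G \<Lambda>" by metis
  from verma_ideal_mult[OF this, of "scal (1 / (c - d))"] \<open>c \<noteq> d\<close> nontrivial
  show False by (simp add: scal_mult)
qed

lemma vac_expectI:
  "l \<in> dual_ideal G \<Lambda> \<Longrightarrow> r \<in> verma_ideal G \<Lambda> \<Longrightarrow> vac_expect G \<Lambda> (scal c + l + r) = c"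
  unfolding vac_expect_def by (rule the_equality) (auto dest: vacuum_unique)

lemma vac_expect_scal [simp]: "vac_expect G \<Lambda> (scal c) = c"
  using vac_expectI[OF dual_ideal_0 verma_ideal_0, of c] by simp

lemma vac_expect_add: "vac_expect G \<Lambda> (u + v) = vac_expect G \<Lambda> u + vac_expect G \<Lambda> v"
proof -
  obtain c l r where u: "u = scal c + l + r" "l \<in> dual_ideal G \<Lambda>" "r \<in> verma_ideal G \<Lambda>"
    using vacuum_decomposition by metis
  obtain d m s where v: "v = scal d + m + s" "m \<in> dual_ideal G \<Lambda>" "s \<in> verma_ideal G \<Lambda>"
    using vacuum_decomposition by metis
  have "u + v = scal (c + d) + (l + m) + (r + s)" by (simp add: u v scal_add)
  then have "vac_expect G \<Lambda> (u + v) = c + d"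
    by (simp only: vac_expectI dual_ideal_add verma_ideal_add u v)
  then show ?thesis using u v by (simp add: vac_expectI)
qed

lemma vac_expect_dual: "u \<in> dual_ideal G \<Lambda> \<Longrightarrow> vac_expect G \<Lambda> u = 0"
  using vac_expectI[OF _ verma_ideal_0, of u 0] by simp

lemma vac_expect_verma: "u \<in> verma_ideal G \<Lambda> \<Longrightarrow> vac_expect G \<Lambda> u = 0"
  using vac_expectI[OF dual_ideal_0, of u 0] by simp

lemma vac_expect_cong_verma: "u - v \<in> verma_ideal G \<Lambda> \<Longrightarrow> vac_expect G \<Lambda> u = vac_expect G \<Lambda> v"
  using vac_expect_add[of "u - v" v] vac_expect_verma by simp

lemma vac_expect_cong_dual: "u - v \<in> dual_ideal G \<Lambda> \<Longrightarrow> vac_expect G \<Lambda> u = vac_expect G \<Lambda> v"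
  using vac_expect_add[of "u - v" v] vac_expect_dual by simp

lemma vac_expect_scal_mult: "vac_expect G \<Lambda> (scal c * u) = c * vac_expect G \<Lambda> u"
proof -
  obtain d l r where u: "u = scal d + l + r" "l \<in> dual_ideal G \<Lambda>" "r \<in> verma_ideal G \<Lambda>"
    using vacuum_decomposition by metis
  have "scal c * u = scal (c * d) + l * scal c + scal c * r"
    by (simp add: u distrib_left scal_mult scal_commute[of l])
  then have "vac_expect G \<Lambda> (scal c * u) = c * d"
    by (simp only: vac_expectI dual_ideal_mult verma_ideal_mult u)
  then show ?thesis using u by (simp add: vac_expectI)
qed

lemma vac_expect_sum: "vac_expect G \<Lambda> (sum f A) = (\<Sum>i\<in>A. vac_expect G \<Lambda> (f i))"
  using vac_expect_scal[of 0]
  by (induction A rule: infinite_finite_induct) (simp_all add: vac_expect_add)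

text \<open>A change of \<open>u\<close> alters the product by an element of the right ideal, a
  change of \<open>v\<close> by one of the left ideal, and the expectation vanishes on both. This
  resolves the definite description in \<open>pairing\<close>.\<close>

lemma pairing_vec: "pairing G \<Lambda> (dual_vec G \<Lambda> u) (verma_vec G \<Lambda> v) = vac_expect G \<Lambda> (u * v)"
proof -
  have eq: "vac_expect G \<Lambda> ((u + l) * (v + r)) = vac_expect G \<Lambda> (u * v)"
    if "l \<in> dual_ideal G \<Lambda>" "r \<in> verma_ideal G \<Lambda>" for l r
  proof -
    have "vac_expect G \<Lambda> ((u + l) * (v + r)) = vac_expect G \<Lambda> (u * (v + r))"
      using dual_ideal_mult[OF that(1), of "v + r"]
      by (intro vac_expect_cong_dual) (simp add: algebra_simps)
    also have "\<dots> = vac_expect G \<Lambda> (u * v)"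
      using verma_ideal_mult[OF that(2), of u]
      by (intro vac_expect_cong_verma) (simp add: algebra_simps)
    finally show ?thesis .
  qed
  show ?thesis unfolding pairing_def
  proof (rule the_equality)
    show "\<forall>x\<in>dual_vec G \<Lambda> u. \<forall>y\<in>verma_vec G \<Lambda> v. vac_expect G \<Lambda> (x * y) = vac_expect G \<Lambda> (u * v)"
      by (auto simp: dual_vec_def verma_vec_def eq)
  next
    fix c assume "\<forall>x\<in>dual_vec G \<Lambda> u. \<forall>y\<in>verma_vec G \<Lambda> v. vac_expect G \<Lambda> (x * y) = c"
    moreover have "u + 0 \<in> dual_vec G \<Lambda> u" "v + 0 \<in> verma_vec G \<Lambda> v"
      unfolding dual_vec_def verma_vec_def using dual_ideal_0 verma_ideal_0 by blast+
    ultimately show "c = vac_expect G \<Lambda> (u * v)" by fastforce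
  qed
qed

end

section \<open>The bilinear form and the vertex weights\<close>

lemma form_add_left: "form G (X + Y) Z = form G X Z + form G Y Z"
  and form_add_right: "form G Z (X + Y) = form G Z X + form G Z Y"
  by (simp_all add: form_def algebra_simps sum.distrib)

lemma form_scale_left: "form G (wscale c X) Y = c * form G X Y"
  and form_scale_right: "form G Y (wscale c X) = c * form G Y X"
  by (simp_all add: form_def wscale_def algebra_simps sum_distrib_left)

lemma wscale_uminus: "wscale (-1) X = - X"
  by (simp add: wscale_def prod_eq_iff)

lemma form_diff_left: "form G (X - Y) Z = form G X Z - form G Y Z"
  using form_add_left[of G X "wscale (-1) Y" Z] form_scale_left[of G "-1" Y Z]
  by (simp add: wscale_uminus)

lemma form_0_left [simp]: "form G 0 X = 0"
  and form_0_right [simp]: "form G X 0 = 0"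
  by (simp_all add: form_def)

lemma form_sum_left: "form G (sum f A) Z = (\<Sum>i\<in>A. form G (f i) Z)"
  by (induction A rule: infinite_finite_induct) (simp_all add: form_add_left)

lemma form_sum_right: "form G Z (sum f A) = (\<Sum>i\<in>A. form G Z (f i))"
  by (induction A rule: infinite_finite_induct) (simp_all add: form_add_right)

lemma form_simple_root_right:
  "form G X (simple_root j) =
    of_real (symm G j) * (\<Sum>i\<in>UNIV. of_int (cartan G i j) * (snd X $ i)) + (if j = None then fst X else 0)"
proof -
  have "(\<Sum>k\<in>UNIV. of_int (cartan G i k) * of_real (symm G k) * (snd X $ i) * (axis j 1 $ k)) =
    of_int (cartan G i j) * of_real (symm G j) * (snd X $ i)" for i
    by (subst sum.remove[of _ j]) (auto simp: axis_def)
  then show ?thesis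
    by (auto simp: form_def simple_root_def axis_def sum_distrib_left mult_ac)
qed

lemma form_simple_roots:
  "form G (simple_root i) (simple_root j) = of_int (cartan G i j) * of_real (symm G j)"
proof -
  have "(\<Sum>k\<in>UNIV. of_int (cartan G k j) * (axis i 1 $ k)) = (of_int (cartan G i j) :: complex)" for j
    by (subst sum.remove[of _ i]) (auto simp: axis_def)
  then show ?thesis by (simp add: form_simple_root_right) (simp add: simple_root_def)
qed

lemma form_coroot: "form G X (coroot G i) = form G X (simple_root i) / of_real (symm G i)"
  by (simp add: coroot_def form_scale_right)

lemma form_root_vec_left: "form G (root_vec \<beta>) Y = (\<Sum>i\<in>UNIV. of_nat (\<beta> i) * form G (simple_root i) Y)"
  by (simp add: root_vec_def form_sum_left form_scale_left)

lemma form_root_vec_right: "form G Y (root_vec \<beta>) = (\<Sum>i\<in>UNIV. of_nat (\<beta> i) * form G Y (simple_root i))"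
  by (simp add: root_vec_def form_sum_right form_scale_right)

lemma root_vec_add_root: "root_vec (add_root \<beta> i) = root_vec \<beta> + simple_root i"
proof -
  have "root_vec (add_root \<beta> i) = (\<Sum>j\<in>UNIV. wscale (of_nat (\<beta> j)) (simple_root j) +
      (if j = i then simple_root i else 0))"
    unfolding root_vec_def
    by (intro sum.cong) (auto simp: add_root_def wscale_def simple_root_def algebra_simps prod_eq_iff)
  then show ?thesis by (simp add: sum.distrib root_vec_def)
qed

lemma form_Lambda0_right: "form G X Lambda0 = snd X $ None"
  by (simp add: form_def Lambda0_def)

lemma sum_option: "(\<Sum>i\<in>(UNIV :: 'i::finite option set). f i) = f None + (\<Sum>i\<in>UNIV. f (Some i))"
  by (simp add: UNIV_option_conv sum.reindex)

section \<open>The level, the fundamental weights and the affine \<rho>\<close>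

context
  fixes G :: "'n::finite affine_data"
  assumes G: "untwisted_affine G"
begin

lemma symm_nonzero [simp]: "symm G i \<noteq> 0"
  using G unfolding untwisted_affine_def by (metis less_irrefl)

lemma cartan_diag: "cartan G i i = 2"
  using G by (simp add: untwisted_affine_def gen_cartan_matrix_def)

lemma cartan_symm: "of_int (cartan G i j) * complex_of_real (symm G j) = of_int (cartan G j i) * of_real (symm G i)"
proof -
  have "of_int (cartan G i j) * symm G j = of_int (cartan G j i) * symm G i"
    using G by (simp add: untwisted_affine_def)
  then show ?thesis by (metis of_real_mult of_real_of_int_eq)
qed

lemma form_simple_root_coroot: "form G (simple_root i) (coroot G j) = of_int (cartan G i j)"
  by (simp add: form_coroot form_simple_roots)

lemma form_simple_root_eq: "form G X (simple_root i) = of_real (symm G i) * form G X (coroot G i)"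
  by (simp add: form_coroot)

text \<open>The root part of \<open>X\<close> is orthogonal to \<delta> because the marks form a
  null vector of the Cartan matrix; the level survives with coefficient a_0 = 1.\<close>

lemma form_delta: "form G X (delta G) = fst X"
proof -
  have marks: "(\<Sum>j\<in>UNIV. of_nat (mark G j) * of_int (cartan G j i)) = (0 :: complex)" for i
  proof -
    have "(\<Sum>j\<in>UNIV. int (mark G j) * cartan G j i) = 0"
      using G by (simp add: untwisted_affine_def)
    then have "(of_int (\<Sum>j\<in>UNIV. int (mark G j) * cartan G j i) :: complex) = 0" by simp
    then show ?thesis by simp
  qed
  have m0: "mark G None = 1" using G by (simp add: untwisted_affine_def)
  have sum0: "(\<Sum>j\<in>UNIV. of_nat (mark G j) * (if j = None then fst X else 0)) = fst X"
    by (subst sum.remove[of _ None]) (auto simp: m0 intro!: sum.neutral split: if_splits)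
  have "form G X (delta G) = (\<Sum>j\<in>UNIV. of_nat (mark G j) * form G X (simple_root j))"
    by (simp add: delta_def form_sum_right form_scale_right)
  also have "\<dots> = (\<Sum>j\<in>UNIV. \<Sum>i\<in>UNIV. of_nat (mark G j) * (of_int (cartan G i j) * of_real (symm G j) * (snd X $ i)))
      + (\<Sum>j\<in>UNIV. of_nat (mark G j) * (if j = None then fst X else 0))"
    unfolding sum.distrib[symmetric]
    by (intro sum.cong refl) (simp add: form_simple_root_right distrib_left sum_distrib_left mult_ac)
  also note sum0
  \<comment> \<open>The null vector condition sums over the first index of the Cartan matrix, the
    form over the second; the symmetry of C_ij d_j converts one into the other.\<close>
  also have "(\<Sum>j\<in>UNIV. \<Sum>i\<in>UNIV. of_nat (mark G j) * (of_int (cartan G i j) * of_real (symm G j) * (snd X $ i))) =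
      (\<Sum>i\<in>UNIV. \<Sum>j\<in>UNIV. of_nat (mark G j) * (of_int (cartan G j i) * of_real (symm G i) * (snd X $ i)))"
    by (subst sum.swap) (simp only: cartan_symm)
  also have "\<dots> = (\<Sum>i\<in>UNIV. (of_real (symm G i) * (snd X $ i)) * (\<Sum>j\<in>UNIV. of_nat (mark G j) * of_int (cartan G j i)))"
    by (simp add: sum_distrib_left mult_ac)
  finally show ?thesis by (simp add: marks)
qed

text \<open>On a kernel vector the quadratic form of the symmetrized matrix vanishes, so positive
  definiteness forces the vector to be zero.\<close>

lemma fin_cartan_kernel:
  assumes "\<And>j. (\<Sum>i\<in>UNIV. of_int (cartan G (Some i) (Some j)) * x i) = (0 :: real)"
  shows "x i = 0"
proof -
  have "simple_cartan_matrix (\<lambda>i j. cartan G (Some i) (Some j))"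
    using G by (simp add: untwisted_affine_def)
  then obtain D :: "'n \<Rightarrow> real" where D: "\<And>x. x \<noteq> (\<lambda>_. 0) \<Longrightarrow>
      (\<Sum>i\<in>UNIV. \<Sum>j\<in>UNIV. x i * x j * (of_int (cartan G (Some i) (Some j)) * D j)) > 0"
    unfolding simple_cartan_matrix_def by blast
  have "(\<Sum>i\<in>UNIV. \<Sum>j\<in>UNIV. x i * x j * (of_int (cartan G (Some i) (Some j)) * D j)) =
    (\<Sum>j\<in>UNIV. (x j * D j) * (\<Sum>i\<in>UNIV. of_int (cartan G (Some i) (Some j)) * x i))"
    by (subst sum.swap) (simp add: sum_distrib_left mult_ac)
  then have "\<not> (\<Sum>i\<in>UNIV. \<Sum>j\<in>UNIV. x i * x j * (of_int (cartan G (Some i) (Some j)) * D j)) > 0"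
    by (simp add: assms)
  then have "x = (\<lambda>_. 0)" using D[of x] by blast
  then show ?thesis by simp
qed

text \<open>Positivity concerns real vectors, so a complex kernel vector is split into real and
  imaginary parts; surjectivity follows from injectivity by finite dimension.\<close>

lemma fin_cartan_bij:
  "bij (\<lambda>x :: complex ^ 'n. \<chi> j. \<Sum>i\<in>UNIV. of_int (cartan G (Some i) (Some j)) * (x $ i))" (is "bij ?f")
proof -
  have lin: "linear ?f"
    by (intro linearI) (simp_all add: vec_eq_iff algebra_simps sum.distrib scaleR_sum_right)
  have "x = 0" if "?f x = 0" for x
  proof -
    have z: "(\<Sum>i\<in>UNIV. of_int (cartan G (Some i) (Some j)) * (x $ i)) = 0" for j
      using that by (simp add: vec_eq_iff)
    have "Re (\<Sum>i\<in>UNIV. of_int (cartan G (Some i) (Some j)) * (x $ i)) = 0"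
      "Im (\<Sum>i\<in>UNIV. of_int (cartan G (Some i) (Some j)) * (x $ i)) = 0" for j
      by (simp_all add: z)
    then have "Re (x $ i) = 0" "Im (x $ i) = 0" for i
      using fin_cartan_kernel[of "\<lambda>i. Re (x $ i)"] fin_cartan_kernel[of "\<lambda>i. Im (x $ i)"] by simp_all
    then show ?thesis by (simp add: vec_eq_iff complex_eq_iff)
  qed
  then have "inj ?f" using lin by (simp add: linear_injective_0)
  then show ?thesis using linear_injective_imp_surjective[OF lin] by (simp add: bij_def)
qed

text \<open>Orthogonality to \<delta> and to \<open>Lambda0\<close> kills the level and the
  coefficient of \<alpha>_0. What remains is a uniquely solvable system with the finite Cartan
  matrix, which justifies the definite description in \<open>fund_weight\<close>.\<close>

lemma form_fund_weight:
  "form G (fund_weight G i) (delta G) = 0"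
  "form G (fund_weight G i) (coroot G (Some j)) = (if i = j then 1 else 0)"
proof -
  let ?f = "\<lambda>x :: complex ^ 'n. \<chi> j. \<Sum>i\<in>UNIV. of_int (cartan G (Some i) (Some j)) * (x $ i)"
  let ?b = "(\<chi> j. if i = j then 1 else 0) :: complex ^ 'n"
  let ?P = "\<lambda>X. form G X (delta G) = 0 \<and> form G X Lambda0 = 0 \<and>
     (\<forall>j. form G X (coroot G (Some j)) = (if i = j then 1 else 0))"
  have P: "?P X \<longleftrightarrow> fst X = 0 \<and> snd X $ None = 0 \<and> ?f (\<chi> k. snd X $ Some k) = ?b" for X
    by (auto simp: form_delta form_Lambda0_right form_coroot form_simple_root_right sum_option vec_eq_iff)
  obtain x where x: "?f x = ?b" using fin_cartan_bij by (metis (no_types, lifting) bij_pointE)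
  have "\<exists>!X. ?P X"
  proof (rule ex1I)
    show "?P (0, \<chi> k. case k of None \<Rightarrow> 0 | Some k \<Rightarrow> x $ k)"
      unfolding P using x by (simp add: vec_nth_inverse)
  next
    fix X assume "?P X"
    then have X: "fst X = 0" "snd X $ None = 0" "?f (\<chi> k. snd X $ Some k) = ?f x" unfolding P x by auto
    from injD[OF bij_is_inj[OF fin_cartan_bij] X(3)] have "snd X $ Some k = x $ k" for k
      by (auto simp: vec_eq_iff)
    with X show "X = (0, \<chi> k. case k of None \<Rightarrow> 0 | Some k \<Rightarrow> x $ k)"
      by (auto simp: prod_eq_iff vec_eq_iff split: option.split)
  qed
  from theI'[OF this] show "form G (fund_weight G i) (delta G) = 0"
    "form G (fund_weight G i) (coroot G (Some j)) = (if i = j then 1 else 0)"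
    unfolding fund_weight_def by blast+
qed

text \<open>The finite nodes come from the fundamental weights. For the affine node, \<delta> is
  expanded in coroots with coefficients a_i d_i: its pairing with \<open>rho_hat\<close> is the dual
  Coxeter number, the sum of these coefficients, so the one remaining value is also 1.\<close>

lemma form_rho_hat: "form G (rho_hat G) (coroot G i) = 1"
proof -
  have m0: "mark G None = 1" "symm G None = 1" using G by (simp_all add: untwisted_affine_def)
  have fin: "form G (rho_hat G) (coroot G (Some j)) = 1" for j
    by (simp add: rho_hat_def form_add_left form_sum_left form_scale_left form_fund_weight)
      (simp add: form_coroot form_simple_root_right Lambda0_def)
  have "form G (rho_hat G) (delta G) = dual_coxeter G"
    by (simp add: rho_hat_def form_add_left form_sum_left form_scale_left form_fund_weight)
      (simp add: form_delta Lambda0_def)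
  moreover have "form G (rho_hat G) (delta G) =
    (\<Sum>j\<in>UNIV. of_nat (mark G j) * of_real (symm G j) * form G (rho_hat G) (coroot G j))"
    by (simp add: delta_def form_sum_right form_scale_right form_simple_root_eq mult.assoc)
  ultimately have "form G (rho_hat G) (coroot G None) = 1"
    by (simp add: dual_coxeter_def sum_option fin m0 mult.commute)
  with fin show ?thesis by (cases i) auto
qed

lemma form_root_vec_symm: "form G (root_vec \<beta>) (simple_root i) = form G (simple_root i) (root_vec \<beta>)"
  by (simp add: form_root_vec_left form_root_vec_right form_simple_roots cartan_symm)

text \<open>With \<rho> for \<open>rho_hat\<close>, the increment is (\<Lambda> + \<rho> -
  \<beta>|\<alpha>_i) - (\<alpha>_i|\<alpha>_i)/2. Both (\<rho>|\<alpha>_i) and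
  (\<alpha>_i|\<alpha>_i)/2 equal d_i and cancel, leaving d_i times the eigenvalue of h_i in degree
  \<beta>.\<close>

lemma vertex_weight_add_root:
  "vertex_weight G \<Lambda> (add_root \<beta> i) = vertex_weight G \<Lambda> \<beta> +
    of_real (symm G i) * (form G \<Lambda> (coroot G i) - (\<Sum>j\<in>UNIV. of_nat (\<beta> j) * of_int (cartan G j i)))"
proof -
  have "form G (root_vec \<beta>) (simple_root i) =
    of_real (symm G i) * (\<Sum>j\<in>UNIV. of_nat (\<beta> j) * of_int (cartan G j i))"
    by (simp add: form_root_vec_left form_simple_roots sum_distrib_left mult_ac)
  then show ?thesis
    by (simp add: vertex_weight_def root_vec_add_root form_add_left form_add_right
        form_simple_root_eq[of "rho_hat G"] form_simple_root_eq[of \<Lambda>] form_rho_hat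
        form_root_vec_symm[symmetric] form_simple_roots cartan_diag field_simps)
qed

lemma form_weight_coroots:
  "form G (\<Lambda> - root_vec \<beta>) (\<Sum>i\<in>UNIV. wscale (\<phi> i) (coroot G i)) =
    (\<Sum>i\<in>UNIV. \<phi> i * (form G \<Lambda> (coroot G i) - (\<Sum>j\<in>UNIV. of_nat (\<beta> j) * of_int (cartan G j i))))"
  by (simp add: form_sum_right form_scale_right form_diff_left form_root_vec_left form_simple_root_coroot)

end

lemma vertex_weight_0: "vertex_weight G \<Lambda> (\<lambda>_. 0) = 0"
  by (simp add: vertex_weight_def form_root_vec_right)

section \<open>Recursion for the partition functions\<close>

text \<open>Truncated subtraction: it inverts \<open>add_root\<close> only where
  \<open>\<beta> i > 0\<close>, and the recursions sum over such nodes alone.\<close>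

definition sub_root :: "('i \<Rightarrow> nat) \<Rightarrow> 'i \<Rightarrow> ('i \<Rightarrow> nat)" where
  "sub_root \<beta> i = \<beta>(i := \<beta> i - 1)"

lemma sub_add_root [simp]: "sub_root (add_root \<beta> i) i = \<beta>"
  by (simp add: sub_root_def add_root_def)

lemma add_sub_root: "\<beta> i > 0 \<Longrightarrow> add_root (sub_root \<beta> i) i = \<beta>"
  by (simp add: sub_root_def add_root_def)

lemma add_root_pos [simp]: "add_root \<beta> i i > 0"
  by (simp add: add_root_def)

lemma sum_add_root: "sum (add_root \<beta> i) UNIV = Suc (sum \<beta> (UNIV :: 'i::finite set))"
proof -
  have "sum (add_root \<beta> i) UNIV = (\<Sum>j\<in>UNIV. \<beta> j + (if j = i then 1 else 0))"
    by (intro sum.cong) (auto simp: add_root_def)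
  then show ?thesis by (simp add: sum.distrib)
qed

lemma sum_sub_root: "\<beta> i > 0 \<Longrightarrow> sum \<beta> (UNIV :: 'i::finite set) = Suc (sum (sub_root \<beta> i) UNIV)"
  using sum_add_root[of "sub_root \<beta> i" i] by (simp add: add_sub_root)

lemma paths_0: "paths (\<lambda>_. 0) = {[\<lambda>_. 0]}"
proof -
  have "p = [\<lambda>_. 0]" if "p \<in> paths (\<lambda>_. 0)" for p :: "('a \<Rightarrow> nat) list"
  proof -
    have p: "p \<noteq> []" "hd p = (\<lambda>_. 0)" "last p = (\<lambda>_. 0)"
      "\<And>k. Suc k < length p \<Longrightarrow> \<exists>i. p ! Suc k = add_root (p ! k) i"
      using that by (auto simp: paths_def)
    have "length p = 1"
    proof (rule ccontr)
      assume "length p \<noteq> 1"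
      then obtain k where k: "length p = Suc (Suc k)"
        using p(1) by (metis One_nat_def length_0_conv not0_implies_Suc)
      then obtain i where "last p = add_root (p ! k) i"
        using p(4)[of k] p(1) by (auto simp: last_conv_nth)
      then show False using p(3) by (metis add_root_pos less_irrefl)
    qed
    then show ?thesis using p(2) by (auto simp: length_Suc_conv)
  qed
  then show ?thesis by (auto simp: paths_def)
qed

text \<open>A path to a nonzero \<beta> is cut before its last vertex. The last step can be
  recovered from the vertex before it, as the only coordinate that is smaller there.\<close>

lemma paths_step:
  assumes "\<beta> \<noteq> (\<lambda>_. 0)"
  shows "bij_betw (\<lambda>(i, p). p @ [\<beta>]) (SIGMA i:{i. \<beta> i > 0}. paths (sub_root \<beta> i)) (paths \<beta>)"
  unfolding bij_betw_def
proof
  show "inj_on (\<lambda>(i, p). p @ [\<beta>]) (SIGMA i:{i. \<beta> i > 0}. paths (sub_root \<beta> i))"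
  proof (rule inj_onI, clarsimp)
    fix i j p assume "\<beta> i > 0" "\<beta> j > 0" "p \<in> paths (sub_root \<beta> i)" "p \<in> paths (sub_root \<beta> j)"
    then have "sub_root \<beta> i = sub_root \<beta> j" by (auto simp: paths_def)
    then have "sub_root \<beta> i i = sub_root \<beta> j i" by simp
    with \<open>\<beta> i > 0\<close> show "i = j" by (auto simp: sub_root_def split: if_splits)
  qed
  show "(\<lambda>(i, p). p @ [\<beta>]) ` (SIGMA i:{i. \<beta> i > 0}. paths (sub_root \<beta> i)) = paths \<beta>"
  proof (intro equalityI subsetI)
    fix q assume "q \<in> (\<lambda>(i, p). p @ [\<beta>]) ` (SIGMA i:{i. \<beta> i > 0}. paths (sub_root \<beta> i))"
    then obtain i p where q: "q = p @ [\<beta>]" and i: "\<beta> i > 0" and p: "p \<in> paths (sub_root \<beta> i)" by auto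
    have "\<exists>j. q ! Suc k = add_root (q ! k) j" if "Suc k < length q" for k
    proof (cases "Suc k < length p")
      case True
      then show ?thesis using p by (simp add: q nth_append paths_def)
    next
      case False
      then have len: "length p = Suc k" using that q by simp
      then have "p ! k = sub_root \<beta> i" using p by (auto simp: paths_def last_conv_nth)
      with len show ?thesis using i
        by (intro exI[of _ i]) (simp add: q nth_append add_sub_root)
    qed
    then show "q \<in> paths \<beta>" using p by (auto simp: paths_def q)
  next
    fix q assume q: "q \<in> paths \<beta>"
    then obtain p where p: "q = p @ [\<beta>]" by (auto simp: paths_def intro: append_butlast_last_id[symmetric])
    have ne: "p \<noteq> []" using q assms by (auto simp: p paths_def)
    have step: "\<And>k. Suc k < length q \<Longrightarrow> \<exists>i. q ! Suc k = add_root (q ! k) i" using q by (auto simp: paths_def)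
    obtain k where k: "length p = Suc k" using ne by (cases p) auto
    obtain i where i: "\<beta> = add_root (last p) i"
      using step[of k] ne k by (auto simp: p nth_append last_conv_nth)
    have "p \<in> paths (sub_root \<beta> i)"
      unfolding paths_def mem_Collect_eq
    proof (intro conjI allI impI)
      show "hd p = (\<lambda>_. 0)" using q ne by (auto simp: paths_def p)
      show "last p = sub_root \<beta> i" by (simp add: i)
      fix m assume "Suc m < length p"
      then show "\<exists>i. p ! Suc m = add_root (p ! m) i" using step[of m] by (simp add: p nth_append)
    qed fact
    moreover have "\<beta> i > 0" by (subst i) simp
    ultimately show "q \<in> (\<lambda>(i, p). p @ [\<beta>]) ` (SIGMA i:{i. \<beta> i > 0}. paths (sub_root \<beta> i))"
      unfolding p by force
  qed
qed

lemma partition_function_0: "partition_function G \<Lambda> (\<lambda>_. 0) = 1"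
  by (simp add: partition_function_def paths_0 path_weight_def)

text \<open>The product in \<open>path_weight\<close> starts at index 1 and so leaves out the
  origin, whose vertex weight is 0. Since \<open>p\<close> is nonempty, the appended vertex is
  counted.\<close>

lemma path_weight_snoc:
  assumes "p \<noteq> []"
  shows "path_weight G \<Lambda> (p @ [\<beta>]) = path_weight G \<Lambda> p / vertex_weight G \<Lambda> \<beta>"
proof -
  have "{1..<length (p @ [\<beta>])} = insert (length p) {1..<length p}"
    using assms by (auto simp: Suc_le_eq)
  then show ?thesis
    by (auto simp: path_weight_def nth_append intro!: prod.cong)
qed

lemma partition_function_rec:
  fixes G :: "'n::finite affine_data"
  assumes "\<beta> \<noteq> (\<lambda>_. 0)"
  shows "partition_function G \<Lambda> \<beta> =
    (\<Sum>i | \<beta> i > 0. partition_function G \<Lambda> (sub_root \<beta> i)) / vertex_weight G \<Lambda> \<beta>"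
proof -
  have "partition_function G \<Lambda> \<beta> =
    (\<Sum>x\<in>(SIGMA i:{i. \<beta> i > 0}. paths (sub_root \<beta> i)). path_weight G \<Lambda> (case x of (i, p) \<Rightarrow> p @ [\<beta>]))"
    unfolding partition_function_def by (rule sum.reindex_bij_betw[OF paths_step[OF assms], symmetric])
  also have "\<dots> = (\<Sum>i | \<beta> i > 0. \<Sum>p\<in>paths (sub_root \<beta> i). path_weight G \<Lambda> (p @ [\<beta>]))"
    by (subst sum.Sigma) (auto simp: finite_paths intro: sum.cong)
  also have "\<dots> = (\<Sum>i | \<beta> i > 0. partition_function G \<Lambda> (sub_root \<beta> i) / vertex_weight G \<Lambda> \<beta>)"
    unfolding partition_function_def sum_divide_distrib
    by (intro sum.cong refl path_weight_snoc) (auto simp: paths_def)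
  finally show ?thesis by (simp add: sum_divide_distrib)
qed

section \<open>Whittaker vectors\<close>

lemma words_of_degree_keys:
  "words_of_degree K \<beta> = {u. Poly_Mapping.keys u \<subseteq> Word ` {map K is |is. \<forall>i. count_list is i = \<beta> i}}"
  unfolding words_of_degree_def by (rule Collect_cong) blast

lemma words_of_degree_0 [simp]: "0 \<in> words_of_degree K \<beta>"
  by (simp add: words_of_degree_keys)

lemma words_of_degree_add:
  "u \<in> words_of_degree K \<beta> \<Longrightarrow> v \<in> words_of_degree K \<beta> \<Longrightarrow> u + v \<in> words_of_degree K \<beta>"
  unfolding words_of_degree_keys using keys_add[of u v] by auto

lemma words_of_degree_sum:
  "(\<And>i. i \<in> A \<Longrightarrow> f i \<in> words_of_degree K \<beta>) \<Longrightarrow> sum f A \<in> words_of_degree K \<beta>"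
  by (induction A rule: infinite_finite_induct) (auto intro: words_of_degree_add)

lemma words_of_degree_diff:
  "u \<in> words_of_degree K \<beta> \<Longrightarrow> v \<in> words_of_degree K \<beta> \<Longrightarrow> u - v \<in> words_of_degree K \<beta>"
proof -
  have "Poly_Mapping.keys (u - v) \<subseteq> Poly_Mapping.keys u \<union> Poly_Mapping.keys v"
    by (auto simp: in_keys_iff lookup_minus)
  then show "u \<in> words_of_degree K \<beta> \<Longrightarrow> v \<in> words_of_degree K \<beta> \<Longrightarrow> u - v \<in> words_of_degree K \<beta>"
    unfolding words_of_degree_keys by blast
qed

lemma words_of_degree_mon:
  "(\<And>i. count_list is i = \<beta> i) \<Longrightarrow> scal c * mon (map K is) \<in> words_of_degree K \<beta>"
  by (auto simp: words_of_degree_keys simp flip: single_eq_scal_mon)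

lemma words_of_degree_induct [consumes 1, case_names zero add]:
  assumes "u \<in> words_of_degree K \<beta>" and "P 0"
    and "\<And>is c p. (\<And>i. count_list is i = \<beta> i) \<Longrightarrow> P p \<Longrightarrow> P (p + scal c * mon (map K is))"
  shows "P u"
proof -
  have "Poly_Mapping.keys u \<subseteq> Word ` {map K is |is. \<forall>i. count_list is i = \<beta> i}"
    using assms(1) by (simp add: words_of_degree_keys)
  then show ?thesis
    by (induction u rule: falg_induct_on) (auto simp: assms)
qed

lemma words_of_degree_scal: "u \<in> words_of_degree K \<beta> \<Longrightarrow> scal c * u \<in> words_of_degree K \<beta>"
  by (induction u rule: words_of_degree_induct)
    (auto simp: distrib_left scal_mult_left intro: words_of_degree_add words_of_degree_mon)

lemma words_of_degree_gen:
  assumes "u \<in> words_of_degree K \<beta>"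
  shows "gen_elt (K i) * u \<in> words_of_degree K (add_root \<beta> i)"
  using assms
proof (induction u rule: words_of_degree_induct)
  case (add js c p)
  have "scal c * mon (map K (i # js)) \<in> words_of_degree K (add_root \<beta> i)"
    by (rule words_of_degree_mon) (auto simp: add(1) add_root_def)
  then show ?case using words_of_degree_add[OF add(2)] by (simp add: distrib_left gen_scal mon_Cons)
qed simp

lemma words_of_degree_zero_scal:
  assumes "u \<in> words_of_degree K (\<lambda>_. 0)" obtains c where "u = scal c"
proof -
  have "\<exists>c. u = scal c" using assms
  proof (induction u rule: words_of_degree_induct)
    case zero
    show ?case using scal_0 by metis
  next
    case (add js c p)
    then have "set js = {}" by (metis count_list_0_iff equals0I)
    with add show ?case by (auto simp flip: scal_add)
  qed
  then show ?thesis using that by blast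
qed

text \<open>Passes from sums over the letters of a word, as in \<open>hw_h_fmon\<close>, to sums
  over nodes weighted by the degree.\<close>

lemma sum_count_list:
  fixes f :: "'i::finite \<Rightarrow> 'b::comm_semiring_1"
  shows "(\<Sum>j\<leftarrow>js. f j) = (\<Sum>j\<in>UNIV. of_nat (count_list js j) * f j)"
proof (induction js)
  case (Cons k js)
  have "(\<Sum>j\<in>UNIV. of_nat (count_list (k # js) j) * f j) =
    (\<Sum>j\<in>UNIV. of_nat (count_list js j) * f j + (if j = k then f k else 0))"
    by (intro sum.cong) (auto simp: algebra_simps)
  then show ?case by (simp add: Cons sum.distrib add.commute)
qed simp

lemma length_count_list: "length (js :: 'i::finite list) = (\<Sum>j\<in>UNIV. count_list js j)"
  using sum_count_list[of "\<lambda>_. 1 :: nat" js] by (simp add: sum_list_triv)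

lemma words_of_degree_homog:
  fixes \<beta> :: "'n::finite option \<Rightarrow> nat"
  shows "u \<in> words_of_degree Fgen \<beta> \<Longrightarrow> homog (int (sum \<beta> UNIV)) u"
proof (induction u rule: words_of_degree_induct)
  case (add js c p)
  have "fmon js \<in> fspan (int (sum \<beta> UNIV))"
    using add(1) by (intro fspan_fmon) (simp add: length_count_list)
  from homog_add[OF add(2) homog_scal_mult[OF homog_fspan[OF this]]] show ?case .
qed simp

lemma words_of_degree_h:
  assumes "u \<in> words_of_degree Fgen \<beta>"
  shows "h_elt i * u - scal (form G \<Lambda> (coroot G i) - (\<Sum>j\<in>UNIV. of_nat (\<beta> j) * of_int (cartan G j i))) * u
    \<in> verma_ideal G \<Lambda>"
  using assms
proof (induction u rule: words_of_degree_induct)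
  case (add js c p)
  let ?s = "form G \<Lambda> (coroot G i) - (\<Sum>j\<in>UNIV. of_nat (\<beta> j) * of_int (cartan G j i))"
  have "h_elt i * fmon js - scal ?s * fmon js \<in> verma_ideal G \<Lambda>"
    using hw_h_fmon[OF highest_weight_vec_1, of i js G \<Lambda>] by (simp add: sum_count_list add(1))
  then have "(h_elt i * p - scal ?s * p) + scal c * (h_elt i * fmon js - scal ?s * fmon js) \<in> verma_ideal G \<Lambda>"
    by (intro verma_ideal_add verma_ideal_mult add(2))
  also have "(h_elt i * p - scal ?s * p) + scal c * (h_elt i * fmon js - scal ?s * fmon js) =
    h_elt i * (p + scal c * fmon js) - scal ?s * (p + scal c * fmon js)"
    by (simp add: distrib_left right_diff_distrib gen_scal scal_mult_left mult.commute)
  finally show ?case .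
qed simp

text \<open>No letter f_i occurs, so e_i passes through every letter and reaches the vacuum. This
  covers the boundary degrees, where \<beta> - \<alpha>_i leaves the cone.\<close>

lemma words_of_degree_e:
  assumes "u \<in> words_of_degree Fgen \<beta>" and "\<beta> i = 0"
  shows "e_elt i * u \<in> verma_ideal G \<Lambda>"
  using assms(1)
proof (induction u rule: words_of_degree_induct)
  case (add js c p)
  have "e_elt i * fmon js \<in> verma_ideal G \<Lambda>" if "i \<notin> set js" for js
    using that
  proof (induction js)
    case Nil
    show ?case by (simp add: e_in_verma)
  next
    case (Cons j js)
    have "(comm (e_elt i) (f_elt j) - (if i = j then h_elt j else 0)) * fmon js + f_elt j * (e_elt i * fmon js)
      \<in> verma_ideal G \<Lambda>"
      using Cons by (intro verma_ideal_add[OF relators_in_verma[OF relators.ef] verma_ideal_mult]) simp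
    then show ?case using Cons(2) by (simp add: mon_Cons comm_def algebra_simps)
  qed
  moreover have "i \<notin> set js" using add(1)[of i] assms(2) by (simp add: count_list_0_iff)
  ultimately have "e_elt i * p + scal c * (e_elt i * fmon js) \<in> verma_ideal G \<Lambda>"
    by (intro verma_ideal_add[OF add(2) verma_ideal_mult])
  then show ?case by (simp add: distrib_left gen_scal)
qed simp

lemma anti_words:
  assumes "u \<in> words_of_degree K \<beta>" and K: "\<And>i. gswap (K i) = L i"
  shows "anti u \<in> words_of_degree L \<beta>"
  using assms(1)
proof (induction u rule: words_of_degree_induct)
  case (add js c p)
  have "anti (scal c * mon (map K js)) = scal c * mon (map L (rev js))"
    by (simp add: K comp_def anti_single rev_map flip: single_eq_scal_mon)
  moreover have "scal c * mon (map L (rev js)) \<in> words_of_degree L \<beta>"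
    using add(1) by (intro words_of_degree_mon) simp
  ultimately show ?case using add(2) by (simp add: anti_add words_of_degree_add)
qed simp

lemma prod_sub_root:
  fixes x :: "'i::finite \<Rightarrow> complex"
  assumes "\<beta> i > 0"
  shows "(\<Prod>k\<in>UNIV. x k ^ \<beta> k) = x i * (\<Prod>k\<in>UNIV. x k ^ sub_root \<beta> i k)"
proof -
  have "(\<Prod>k\<in>UNIV. x k ^ \<beta> k) = (\<Prod>k\<in>UNIV. (if k = i then x i else 1) * x k ^ sub_root \<beta> i k)"
    using assms by (intro prod.cong refl) (auto simp: sub_root_def simp flip: power_Suc)
  then show ?thesis by (simp add: prod.distrib)
qed

lemma exp_sums_complex: "(\<lambda>n. c ^ n / fact n) sums exp (c :: complex)"
  using exp_converges[of c] by (simp add: scaleR_conv_of_real divide_inverse mult.commute)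

text \<open>Representatives in the free algebra are built rather than cosets, so that
  \<open>anti\<close> applies to them directly. Degree 0 is set apart because its vertex weight is
  0.\<close>

function whit :: "'n::finite affine_data \<Rightarrow> 'n weight \<Rightarrow> ('n option \<Rightarrow> complex) \<Rightarrow>
    ('n option \<Rightarrow> nat) \<Rightarrow> 'n falg" where
  "whit G \<Lambda> \<mu> \<beta> = (if \<beta> = (\<lambda>_. 0) then 1 else scal (1 / vertex_weight G \<Lambda> \<beta>) *
     (\<Sum>i | \<beta> i > 0. scal (of_real (symm G i) * \<mu> i) * (f_elt i * whit G \<Lambda> \<mu> (sub_root \<beta> i))))"
  by auto
termination
  by (relation "Wellfounded.measure (\<lambda>(G, \<Lambda>, \<mu>, \<beta>). sum \<beta> UNIV)") (auto simp: sum_sub_root)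

declare whit.simps [simp del]

lemma whit_0 [simp]: "whit G \<Lambda> \<mu> (\<lambda>_. 0) = 1"
  by (simp add: whit.simps)

lemma whit_words: "whit G \<Lambda> \<mu> \<beta> \<in> words_of_degree Fgen \<beta>"
proof (induction "sum \<beta> UNIV" arbitrary: \<beta>)
  case 0
  then have "\<beta> = (\<lambda>_. 0)" by auto
  then show ?case using words_of_degree_mon[of "[]" "\<lambda>_. 0" 1 Fgen] by simp
next
  case (Suc n)
  then have ne: "\<beta> \<noteq> (\<lambda>_. 0)" by auto
  have "whit G \<Lambda> \<mu> (sub_root \<beta> i) \<in> words_of_degree Fgen (sub_root \<beta> i)" if "\<beta> i > 0" for i
    using Suc(2) sum_sub_root[of \<beta> i] that by (intro Suc(1)) simp
  from words_of_degree_gen[where K = Fgen, OF this]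
  have "f_elt i * whit G \<Lambda> \<mu> (sub_root \<beta> i) \<in> words_of_degree Fgen \<beta>" if "\<beta> i > 0" for i
    using that add_sub_root[of \<beta> i] by metis
  then show ?case unfolding whit.simps[of _ _ _ \<beta>] using ne
    by (auto intro!: words_of_degree_scal words_of_degree_sum)
qed

section \<open>The Whittaker vectors and their pairing for generic \<Lambda>\<close>

context
  fixes G :: "'n::finite affine_data" and \<Lambda> :: "'n weight"
  assumes G: "untwisted_affine G" and gen: "generic G \<Lambda>"
begin

lemma irreducible: "verma_irreducible G \<Lambda>"
  using gen by (simp add: generic_def)

lemma vertex_weight_nonzero: "\<beta> \<noteq> (\<lambda>_. 0) \<Longrightarrow> vertex_weight G \<Lambda> \<beta> \<noteq> 0"
  using gen by (simp add: generic_def)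

lemma nontrivial: "1 \<notin> verma_ideal G \<Lambda>"
  by (rule irreducible_nonzero[OF irreducible])

text \<open>With the denominator cleared the recursion is uniform: at \<beta> = 0 the weight
  vanishes and the sum is empty.\<close>

lemma whit_rec:
  "scal (vertex_weight G \<Lambda> \<beta>) * whit G \<Lambda> \<mu> \<beta> =
    (\<Sum>i | \<beta> i > 0. scal (of_real (symm G i) * \<mu> i) * (f_elt i * whit G \<Lambda> \<mu> (sub_root \<beta> i)))"
proof (cases "\<beta> = (\<lambda>_. 0)")
  case True
  then show ?thesis by (simp add: vertex_weight_0)
next
  case False
  then show ?thesis using vertex_weight_nonzero[OF False]
    by (simp add: whit.simps[of _ _ _ \<beta>] scal_mult_left)
qed

text \<open>
  By induction and the recursion, \<open>e\<^sub>j\<close> produces \<open>\<mu>\<^sub>j\<close> times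
  \<open>v(\<beta> - \<alpha>\<^sub>j) + (\<Lambda> - \<beta> + \<alpha>\<^sub>j|\<alpha>\<^sub>j) = v(\<beta>)\<close>, the second summand coming from \<open>[e\<^sub>j, f\<^sub>j] = h\<^sub>j\<close>.
\<close>

lemma e_whit: "e_elt j * whit G \<Lambda> \<mu> (add_root \<gamma> j) - scal (\<mu> j) * whit G \<Lambda> \<mu> \<gamma> \<in> verma_ideal G \<Lambda>"
proof (induction "sum \<gamma> UNIV" arbitrary: \<gamma> j rule: less_induct)
  case less
  define \<beta> where "\<beta> = add_root \<gamma> j"
  let ?w = "whit G \<Lambda> \<mu>" and ?d = "\<lambda>i. complex_of_real (symm G i) * \<mu> i"
  let ?s = "form G \<Lambda> (coroot G j) - (\<Sum>k\<in>UNIV. of_nat (\<gamma> k) * of_int (cartan G k j))"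
  \<comment> \<open>\<open>t i\<close> is the expected value of e_j on the i-th summand. The first
    term comes from f_i e_j and the induction hypothesis, the second from [e_j, f_j] = h_j, whose
    eigenvalue in degree \<gamma> is \<open>?s\<close>.\<close>
  define t where "t i = scal (\<mu> j) * (if \<gamma> i > 0 then f_elt i * ?w (sub_root \<gamma> i) else 0)
      + (if i = j then scal ?s * ?w \<gamma> else 0)" for i
  have ft: "e_elt j * (f_elt i * ?w (sub_root \<beta> i)) - t i \<in> verma_ideal G \<Lambda>" if i: "\<beta> i > 0" for i
  proof -
    let ?R = "comm (e_elt j) (f_elt i) - (if j = i then h_elt i else 0)" and ?y = "?w (sub_root \<beta> i)"
    define z where "z = (if \<gamma> i > 0 then ?w (sub_root \<gamma> i) else 0)"
    have R: "?R * ?y \<in> verma_ideal G \<Lambda>" by (intro relators_in_verma relators.ef)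
    have ey: "e_elt j * ?y - scal (\<mu> j) * z \<in> verma_ideal G \<Lambda>"
    proof (cases "\<gamma> i > 0")
      case True
      have "sub_root \<beta> i = add_root (sub_root \<gamma> i) j"
        using True by (auto simp: \<beta>_def sub_root_def add_root_def fun_eq_iff)
      then show ?thesis using less[of "sub_root \<gamma> i" j] sum_sub_root[of \<gamma> i] True by (simp add: z_def)
    next
      \<comment> \<open>Here \<alpha>_i occurs in \<beta> but not in \<gamma>, so i = j and \<beta>
        - \<alpha>_i = \<gamma> contains no \<alpha>_j; hence e_j kills \<open>?y\<close>.\<close>
      case False
      then have "i = j" "sub_root \<beta> i j = 0"
        using i by (auto simp: \<beta>_def add_root_def sub_root_def split: if_splits)
      then show ?thesis using words_of_degree_e[OF whit_words] False by (simp add: z_def)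
    qed
    show ?thesis
    proof (cases "i = j")
      case True
      then have sub: "sub_root \<beta> i = \<gamma>" by (simp add: \<beta>_def)
      have "?R * ?y + f_elt i * (e_elt j * ?y - scal (\<mu> j) * z) + (h_elt j * ?y - scal ?s * ?y) \<in> verma_ideal G \<Lambda>"
        using words_of_degree_h[OF whit_words[of G \<Lambda> \<mu> \<gamma>], of j G \<Lambda>] unfolding sub
        by (intro verma_ideal_add verma_ideal_mult R[unfolded sub] ey[unfolded sub])
      then show ?thesis using True unfolding t_def z_def sub
        by (auto simp: comm_def algebra_simps gen_scal)
    next
      case False
      have "?R * ?y + f_elt i * (e_elt j * ?y - scal (\<mu> j) * z) \<in> verma_ideal G \<Lambda>"
        by (intro verma_ideal_add verma_ideal_mult R ey)
      then show ?thesis using False unfolding t_def z_def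
        by (auto simp: comm_def algebra_simps gen_scal)
    qed
  qed
  have "(\<Sum>i | \<beta> i > 0. scal (?d i) * t i) =
    (\<Sum>i | \<beta> i > 0. scal (\<mu> j) * (if \<gamma> i > 0 then scal (?d i) * (f_elt i * ?w (sub_root \<gamma> i)) else 0)) +
    (\<Sum>i | \<beta> i > 0. if i = j then scal (?d j * ?s) * ?w \<gamma> else 0)"
    unfolding sum.distrib[symmetric] t_def
    by (intro sum.cong refl) (auto simp: distrib_left scal_mult_left mult_ac)
  \<comment> \<open>The index sets differ at most in j, and where they differ the summand is 0; the
    remaining sum is the recursion at \<gamma>.\<close>
  also have "(\<Sum>i | \<beta> i > 0. scal (\<mu> j) * (if \<gamma> i > 0 then scal (?d i) * (f_elt i * ?w (sub_root \<gamma> i)) else 0)) =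
     scal (\<mu> j) * (\<Sum>i | \<gamma> i > 0. scal (?d i) * (f_elt i * ?w (sub_root \<gamma> i)))"
    unfolding sum_distrib_left[symmetric]
    by (intro arg_cong[of _ _ "(*) _"] sum.mono_neutral_cong_right) (auto simp: \<beta>_def add_root_def)
  also have "(\<Sum>i | \<gamma> i > 0. scal (?d i) * (f_elt i * ?w (sub_root \<gamma> i))) =
      scal (vertex_weight G \<Lambda> \<gamma>) * ?w \<gamma>" by (rule whit_rec[symmetric])
  also have "(\<Sum>i | \<beta> i > 0. if i = j then scal (?d j * ?s) * ?w \<gamma> else 0) = scal (?d j * ?s) * ?w \<gamma>"
    by (subst sum.delta) (auto simp: \<beta>_def)
  \<comment> \<open>The contribution d_j \<open>?s\<close> of h_j is exactly the increment from
    v(\<gamma>) to v(\<beta>).\<close>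
  also have "scal (\<mu> j) * (scal (vertex_weight G \<Lambda> \<gamma>) * ?w \<gamma>) + scal (?d j * ?s) * ?w \<gamma> =
      scal (vertex_weight G \<Lambda> \<beta>) * (scal (\<mu> j) * ?w \<gamma>)"
    unfolding \<beta>_def vertex_weight_add_root[OF G]
    by (simp only: scal_mult_left flip: distrib_right scal_add) (simp add: algebra_simps)
  finally have sum_t: "(\<Sum>i | \<beta> i > 0. scal (?d i) * t i) = scal (vertex_weight G \<Lambda> \<beta>) * (scal (\<mu> j) * ?w \<gamma>)" .
  have "(\<Sum>i | \<beta> i > 0. scal (?d i) * (e_elt j * (f_elt i * ?w (sub_root \<beta> i)) - t i)) \<in> verma_ideal G \<Lambda>"
    by (intro verma_ideal_sum verma_ideal_mult ft) simp
  also have "(\<Sum>i | \<beta> i > 0. scal (?d i) * (e_elt j * (f_elt i * ?w (sub_root \<beta> i)) - t i)) =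
      e_elt j * (\<Sum>i | \<beta> i > 0. scal (?d i) * (f_elt i * ?w (sub_root \<beta> i))) - (\<Sum>i | \<beta> i > 0. scal (?d i) * t i)"
    by (simp add: right_diff_distrib sum_subtractf sum_distrib_left gen_scal)
  also have "\<dots> = scal (vertex_weight G \<Lambda> \<beta>) * (e_elt j * ?w \<beta> - scal (\<mu> j) * ?w \<gamma>)"
    unfolding sum_t whit_rec[symmetric] by (simp add: right_diff_distrib gen_scal)
  finally have "scal (1 / vertex_weight G \<Lambda> \<beta>) * (scal (vertex_weight G \<Lambda> \<beta>) * (e_elt j * ?w \<beta> - scal (\<mu> j) * ?w \<gamma>))
      \<in> verma_ideal G \<Lambda>" by (rule verma_ideal_mult)
  moreover have "vertex_weight G \<Lambda> \<beta> \<noteq> 0"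
    by (rule vertex_weight_nonzero) (metis \<beta>_def add_root_pos less_irrefl)
  ultimately show ?case by (simp add: scal_mult_left \<beta>_def)
qed

text \<open>By induction the difference at a nonzero \<beta> is killed by every e_i; having positive
  degree, it vanishes by \<open>hw_in_verma_ideal\<close>. In degree 0 the normalization fixes the
  scalar.\<close>

lemma whit_unique:
  assumes u: "\<And>\<beta>. u \<beta> \<in> words_of_degree Fgen \<beta>" and "vac_expect G \<Lambda> (u (\<lambda>_. 0)) = 1"
    and e: "\<And>i \<beta>. e_elt i * u (add_root \<beta> i) - scal (\<mu> i) * u \<beta> \<in> verma_ideal G \<Lambda>"
  shows "u \<beta> - whit G \<Lambda> \<mu> \<beta> \<in> verma_ideal G \<Lambda>"
proof (induction "sum \<beta> UNIV" arbitrary: \<beta> rule: less_induct)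
  case less
  let ?x = "u \<beta> - whit G \<Lambda> \<mu> \<beta>"
  show ?case
  proof (cases "\<beta> = (\<lambda>_. 0)")
    case True
    obtain c where "u (\<lambda>_. 0) = scal c" using words_of_degree_zero_scal[OF u] .
    moreover from this have "c = 1" using assms(2) vac_expect_scal[OF nontrivial] by simp
    ultimately show ?thesis using True by simp
  next
    case False
    have x: "?x \<in> words_of_degree Fgen \<beta>" by (intro words_of_degree_diff u whit_words)
    have "e_elt i * ?x \<in> verma_ideal G \<Lambda>" for i
    proof (cases "\<beta> i > 0")
      case False
      then show ?thesis by (intro words_of_degree_e[OF x]) simp
    next
      case True
      let ?\<gamma> = "sub_root \<beta> i"
      have "(e_elt i * u \<beta> - scal (\<mu> i) * u ?\<gamma>) + scal (\<mu> i) * (u ?\<gamma> - whit G \<Lambda> \<mu> ?\<gamma>)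
          - (e_elt i * whit G \<Lambda> \<mu> \<beta> - scal (\<mu> i) * whit G \<Lambda> \<mu> ?\<gamma>) \<in> verma_ideal G \<Lambda>"
        using e[of i ?\<gamma>] e_whit[of i \<mu> ?\<gamma>] less[of ?\<gamma>] sum_sub_root[of \<beta> i] True
        by (intro verma_ideal_diff[OF verma_ideal_add[OF _ verma_ideal_mult]]) (simp_all add: add_sub_root)
      then show ?thesis by (simp add: algebra_simps)
    qed
    then have "highest_weight_vec G \<Lambda> (\<lambda>i. form G \<Lambda> (coroot G i) -
        (\<Sum>j\<in>UNIV. of_nat (\<beta> j) * of_int (cartan G j i))) ?x"
      unfolding highest_weight_vec_def using words_of_degree_h[OF x] by blast
    moreover have "0 < int (sum \<beta> UNIV)" proof -
      have "sum \<beta> UNIV \<noteq> 0" using False by (auto simp: fun_eq_iff)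
      then show ?thesis by linarith
    qed
    ultimately show ?thesis
      using hw_in_verma_ideal[OF irreducible _ words_of_degree_homog[OF x]] by blast
  qed
qed

text \<open>Existence is \<open>e_whit\<close>; uniqueness is \<open>whit_unique\<close>, applied to
  a representative chosen in each degree.\<close>

lemma whittaker_vec_eq: "whittaker_vec G \<Lambda> \<mu> = (\<lambda>\<beta>. verma_vec G \<Lambda> (whit G \<Lambda> \<mu> \<beta>))"
  unfolding whittaker_vec_def
proof (rule the_equality, intro conjI allI)
  show "verma_vec G \<Lambda> (whit G \<Lambda> \<mu> \<beta>) \<in> verma_piece G \<Lambda> \<beta>" for \<beta>
    unfolding verma_piece_def by (intro imageI whit_words)
  show "pairing G \<Lambda> (dual_vec G \<Lambda> 1) (verma_vec G \<Lambda> (whit G \<Lambda> \<mu> (\<lambda>_. 0))) = 1"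
    using vac_expect_scal[OF nontrivial, of 1] by (simp add: pairing_vec[OF nontrivial])
  show "verma_act G \<Lambda> (e_elt i) (verma_vec G \<Lambda> (whit G \<Lambda> \<mu> (add_root \<beta> i))) =
    verma_act G \<Lambda> (scal (\<mu> i)) (verma_vec G \<Lambda> (whit G \<Lambda> \<mu> \<beta>))" for i \<beta>
    by (simp add: verma_act_vec verma_vec_eq_iff e_whit)
next
  fix w assume w: "(\<forall>\<beta>. w \<beta> \<in> verma_piece G \<Lambda> \<beta>) \<and>
        pairing G \<Lambda> (dual_vec G \<Lambda> 1) (w (\<lambda>_. 0)) = 1 \<and>
        (\<forall>i \<beta>. verma_act G \<Lambda> (e_elt i) (w (add_root \<beta> i)) = verma_act G \<Lambda> (scal (\<mu> i)) (w \<beta>))"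
  then have "\<forall>\<beta>. \<exists>u. u \<in> words_of_degree Fgen \<beta> \<and> w \<beta> = verma_vec G \<Lambda> u"
    by (auto simp: verma_piece_def)
  then obtain u where u: "\<And>\<beta>. u \<beta> \<in> words_of_degree Fgen \<beta>" "\<And>\<beta>. w \<beta> = verma_vec G \<Lambda> (u \<beta>)"
    by metis
  have "u \<beta> - whit G \<Lambda> \<mu> \<beta> \<in> verma_ideal G \<Lambda>" for \<beta>
    using w by (intro whit_unique u) (simp_all add: u(2) pairing_vec[OF nontrivial] verma_act_vec verma_vec_eq_iff)
  then show "w = (\<lambda>\<beta>. verma_vec G \<Lambda> (whit G \<Lambda> \<mu> \<beta>))"
    by (intro ext) (simp add: u(2) verma_vec_eq_iff)
qed

lemma dual_whittaker_vec_eq: "dual_whittaker_vec G \<Lambda> \<mu> = (\<lambda>\<beta>. dual_vec G \<Lambda> (anti (whit G \<Lambda> \<mu> \<beta>)))"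
  unfolding dual_whittaker_vec_def
proof (rule the_equality, intro conjI allI)
  show "dual_vec G \<Lambda> (anti (whit G \<Lambda> \<mu> \<beta>)) \<in> dual_piece G \<Lambda> \<beta>" for \<beta>
    unfolding dual_piece_def by (intro imageI anti_words[OF whit_words]) simp
  show "pairing G \<Lambda> (dual_vec G \<Lambda> (anti (whit G \<Lambda> \<mu> (\<lambda>_. 0)))) (verma_vec G \<Lambda> 1) = 1"
    using vac_expect_scal[OF nontrivial, of 1] anti_scal[of 1] by (simp add: pairing_vec[OF nontrivial])
  show "dual_act G \<Lambda> (dual_vec G \<Lambda> (anti (whit G \<Lambda> \<mu> (add_root \<beta> i)))) (f_elt i) =
    dual_act G \<Lambda> (dual_vec G \<Lambda> (anti (whit G \<Lambda> \<mu> \<beta>))) (scal (\<mu> i))" for i \<beta>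
    by (simp add: dual_act_vec dual_vec_eq_iff dual_ideal_iff anti_diff anti_mult anti_gen e_whit)
next
  fix w assume w: "(\<forall>\<beta>. w \<beta> \<in> dual_piece G \<Lambda> \<beta>) \<and>
        pairing G \<Lambda> (w (\<lambda>_. 0)) (verma_vec G \<Lambda> 1) = 1 \<and>
        (\<forall>i \<beta>. dual_act G \<Lambda> (w (add_root \<beta> i)) (f_elt i) = dual_act G \<Lambda> (w \<beta>) (scal (\<mu> i)))"
  then have "\<forall>\<beta>. \<exists>u. u \<in> words_of_degree Egen \<beta> \<and> w \<beta> = dual_vec G \<Lambda> u"
    by (auto simp: dual_piece_def)
  then obtain u where u: "\<And>\<beta>. u \<beta> \<in> words_of_degree Egen \<beta>" "\<And>\<beta>. w \<beta> = dual_vec G \<Lambda> (u \<beta>)"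
    by metis
  \<comment> \<open>Under \<open>anti\<close> the conditions on the right module become those of a
    Whittaker vector in the Verma module, so the same uniqueness applies.\<close>
  have "anti (u \<beta>) - whit G \<Lambda> \<mu> \<beta> \<in> verma_ideal G \<Lambda>" for \<beta>
  proof (rule whit_unique)
    show "anti (u \<beta>) \<in> words_of_degree Fgen \<beta>" for \<beta> by (rule anti_words[OF u(1)]) simp
    obtain c where c: "u (\<lambda>_. 0) = scal c" using words_of_degree_zero_scal[OF u(1)] .
    show "vac_expect G \<Lambda> (anti (u (\<lambda>_. 0))) = 1"
      using w by (simp add: u(2) c pairing_vec[OF nontrivial])
    show "e_elt i * anti (u (add_root \<beta> i)) - scal (\<mu> i) * anti (u \<beta>) \<in> verma_ideal G \<Lambda>" for i \<beta>
      using w by (simp add: u(2) dual_act_vec dual_vec_eq_iff dual_ideal_iff anti_diff anti_mult anti_gen)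
  qed
  then show "w = (\<lambda>\<beta>. dual_vec G \<Lambda> (anti (whit G \<Lambda> \<mu> \<beta>)))"
    by (intro ext) (simp add: u(2) dual_vec_eq_iff dual_ideal_iff anti_diff)
qed

text \<open>A step \<alpha>_i contributes d_i \<mu>_i from the recursion of the right vector and
  \<mu>'_i from the left vector. Every path to \<beta> uses \<alpha>_i exactly \<beta>_i times, so
  the product of these factors is common to all paths.\<close>

lemma whit_norm:
  "vac_expect G \<Lambda> (anti (whit G \<Lambda> \<mu>' \<beta>) * whit G \<Lambda> \<mu> \<beta>) =
    (\<Prod>i\<in>UNIV. (of_real (symm G i) * \<mu> i * \<mu>' i) ^ \<beta> i) * partition_function G \<Lambda> \<beta>"
proof (induction "sum \<beta> UNIV" arbitrary: \<beta> rule: less_induct)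
  case less
  let ?A = "\<lambda>\<beta>. vac_expect G \<Lambda> (anti (whit G \<Lambda> \<mu>' \<beta>) * whit G \<Lambda> \<mu> \<beta>)"
  let ?c = "\<lambda>i. of_real (symm G i) * \<mu> i * \<mu>' i"
  note vac = vac_expect_scal[OF nontrivial] vac_expect_sum[OF nontrivial] vac_expect_scal_mult[OF nontrivial]
  show ?case
  proof (cases "\<beta> = (\<lambda>_. 0)")
    case True
    then show ?thesis using vac(1)[of 1] anti_scal[of 1] by (simp add: partition_function_0)
  next
    case False
    have ft: "vac_expect G \<Lambda> (anti (whit G \<Lambda> \<mu>' \<beta>) * (f_elt i * whit G \<Lambda> \<mu> (sub_root \<beta> i))) = \<mu>' i * ?A (sub_root \<beta> i)"
      if i: "\<beta> i > 0" for i
    proof -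
      let ?\<gamma> = "sub_root \<beta> i"
      \<comment> \<open>The eigenvector relation \<open>e_whit\<close> for \<mu>', seen through
        \<open>anti\<close>: acting by f_i on the left vector lowers its degree.\<close>
      have "anti (whit G \<Lambda> \<mu>' \<beta>) * f_elt i - scal (\<mu>' i) * anti (whit G \<Lambda> \<mu>' ?\<gamma>) \<in> dual_ideal G \<Lambda>"
        using e_whit[of i \<mu>' ?\<gamma>] i
        by (simp add: dual_ideal_iff anti_diff anti_mult anti_gen add_sub_root scal_commute)
      from dual_ideal_mult[OF this, of "whit G \<Lambda> \<mu> ?\<gamma>"]
      have "vac_expect G \<Lambda> (anti (whit G \<Lambda> \<mu>' \<beta>) * (f_elt i * whit G \<Lambda> \<mu> ?\<gamma>)) =
        vac_expect G \<Lambda> (scal (\<mu>' i) * (anti (whit G \<Lambda> \<mu>' ?\<gamma>) * whit G \<Lambda> \<mu> ?\<gamma>))"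
        by (intro vac_expect_cong_dual[OF nontrivial]) (simp add: left_diff_distrib mult.assoc)
      then show ?thesis by (simp add: vac)
    qed
    \<comment> \<open>The factor v(\<beta>) is moved onto the right vector so that
      \<open>whit_rec\<close> can be inserted; it is divided out again at the end.\<close>
    have "vertex_weight G \<Lambda> \<beta> * ?A \<beta> =
      vac_expect G \<Lambda> (anti (whit G \<Lambda> \<mu>' \<beta>) * (scal (vertex_weight G \<Lambda> \<beta>) * whit G \<Lambda> \<mu> \<beta>))"
      by (simp only: mult_scal_left vac)
    also have "\<dots> = (\<Sum>i | \<beta> i > 0. of_real (symm G i) * \<mu> i *
        vac_expect G \<Lambda> (anti (whit G \<Lambda> \<mu>' \<beta>) * (f_elt i * whit G \<Lambda> \<mu> (sub_root \<beta> i))))"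
      unfolding whit_rec sum_distrib_left by (simp only: mult_scal_left vac)
    also have "\<dots> = (\<Sum>i | \<beta> i > 0. (\<Prod>k\<in>UNIV. ?c k ^ \<beta> k) * partition_function G \<Lambda> (sub_root \<beta> i))"
    proof (intro sum.cong refl)
      fix i assume i: "i \<in> {i. \<beta> i > 0}"
      then have "?A (sub_root \<beta> i) = (\<Prod>k\<in>UNIV. ?c k ^ sub_root \<beta> i k) * partition_function G \<Lambda> (sub_root \<beta> i)"
        by (intro less) (simp add: sum_sub_root)
      then show "of_real (symm G i) * \<mu> i *
          vac_expect G \<Lambda> (anti (whit G \<Lambda> \<mu>' \<beta>) * (f_elt i * whit G \<Lambda> \<mu> (sub_root \<beta> i))) =
          (\<Prod>k\<in>UNIV. ?c k ^ \<beta> k) * partition_function G \<Lambda> (sub_root \<beta> i)"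
        using i ft[of i] prod_sub_root[of \<beta> i ?c] by simp
    qed
    also have "\<dots> = (\<Prod>k\<in>UNIV. ?c k ^ \<beta> k) * (\<Sum>i | \<beta> i > 0. partition_function G \<Lambda> (sub_root \<beta> i))"
      by (rule sum_distrib_left[symmetric])
    finally have "?A \<beta> = (\<Prod>k\<in>UNIV. ?c k ^ \<beta> k) *
        (\<Sum>i | \<beta> i > 0. partition_function G \<Lambda> (sub_root \<beta> i)) / vertex_weight G \<Lambda> \<beta>"
      using vertex_weight_nonzero[OF False] by (simp add: nonzero_eq_divide_eq mult.commute)
    then show ?thesis by (simp add: partition_function_rec[OF False])
  qed
qed

text \<open>Each h_i acts in degree \<beta> by a scalar, so the n-th power of \<Sum> \<phi>_i h_i
  acts by the n-th power of a single number, and the series over n is the ordinary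
  exponential.\<close>

lemma whittaker_function_eq:
  "whittaker_function G \<Lambda> \<mu> \<mu>' \<beta> \<phi> =
    exp (form G (\<Lambda> - root_vec \<beta>) (\<Sum>i\<in>UNIV. wscale (\<phi> i) (coroot G i))) *
    vac_expect G \<Lambda> (anti (whit G \<Lambda> \<mu>' \<beta>) * whit G \<Lambda> \<mu> \<beta>)"
proof -
  let ?w = "whit G \<Lambda> \<mu> \<beta>" and ?w' = "whit G \<Lambda> \<mu>' \<beta>"
  let ?c = "form G (\<Lambda> - root_vec \<beta>) (\<Sum>i\<in>UNIV. wscale (\<phi> i) (coroot G i))"
  let ?s = "\<lambda>i. form G \<Lambda> (coroot G i) - (\<Sum>j\<in>UNIV. of_nat (\<beta> j) * of_int (cartan G j i))"
  let ?H = "\<Sum>i\<in>UNIV. scal (\<phi> i) * h_elt i :: 'n falg"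
  have "(\<Sum>i\<in>UNIV. scal (\<phi> i) * (h_elt i * ?w - scal (?s i) * ?w)) \<in> verma_ideal G \<Lambda>"
    by (intro verma_ideal_sum verma_ideal_mult words_of_degree_h whit_words)
  also have "(\<Sum>i\<in>UNIV. scal (\<phi> i) * (h_elt i * ?w - scal (?s i) * ?w)) = ?H * ?w - scal ?c * ?w"
    unfolding form_weight_coroots[OF G] scal_sum sum_distrib_right sum_subtractf[symmetric]
    by (intro sum.cong refl) (simp only: right_diff_distrib scal_mult_left mult.assoc)
  finally have H: "?H * ?w - scal ?c * ?w \<in> verma_ideal G \<Lambda>" .
  have Hn: "?H ^ n * ?w - scal (?c ^ n) * ?w \<in> verma_ideal G \<Lambda>" for n
  proof (induction n)
    case (Suc n)
    have "?H * (?H ^ n * ?w - scal (?c ^ n) * ?w) + scal (?c ^ n) * (?H * ?w - scal ?c * ?w) \<in> verma_ideal G \<Lambda>"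
      by (intro verma_ideal_add verma_ideal_mult Suc H)
    then show ?case
      by (simp add: right_diff_distrib scal_mult_left mult_scal_left[of ?H] mult.assoc mult.commute[of _ ?c])
  qed simp
  have "pairing G \<Lambda> (dual_whittaker_vec G \<Lambda> \<mu>' \<beta>) (verma_act G \<Lambda> (?H ^ n) (whittaker_vec G \<Lambda> \<mu> \<beta>)) =
      ?c ^ n * vac_expect G \<Lambda> (anti ?w' * ?w)" for n
  proof -
    have "vac_expect G \<Lambda> (anti ?w' * (?H ^ n * ?w)) = vac_expect G \<Lambda> (anti ?w' * (scal (?c ^ n) * ?w))"
      using verma_ideal_mult[OF Hn, of "anti ?w'"]
      by (intro vac_expect_cong_verma[OF nontrivial]) (simp add: right_diff_distrib)
    also have "\<dots> = ?c ^ n * vac_expect G \<Lambda> (anti ?w' * ?w)"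
      by (simp only: mult_scal_left vac_expect_scal_mult[OF nontrivial])
    finally show ?thesis
      by (simp add: whittaker_vec_eq dual_whittaker_vec_eq verma_act_vec pairing_vec[OF nontrivial])
  qed
  then have eq: "whittaker_function G \<Lambda> \<mu> \<mu>' \<beta> \<phi> =
      suminf (\<lambda>n. ?c ^ n / fact n * vac_expect G \<Lambda> (anti ?w' * ?w))"
    by (simp add: whittaker_function_def)
  show ?thesis
    unfolding eq by (rule sums_unique[symmetric], rule sums_mult2, rule exp_sums_complex)
qed

end

theorem theorem4p4:
  fixes G :: "'n::finite affine_data" and k :: complex and lam \<Lambda> :: "'n weight"
    and \<mu> \<mu>' :: "'n option \<Rightarrow> complex"
  assumes "untwisted_affine G"
    and "lam \<in> fin_weights"
    and "\<Lambda> = wscale k Lambda0 + lam"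
    and "\<forall>n::nat. n > 0 \<longrightarrow> k \<noteq> of_nat n"
    and "k \<noteq> - dual_coxeter G"
    and "generic G \<Lambda>"
    and "\<forall>i. \<mu> i \<noteq> 0" and "\<forall>i. \<mu>' i \<noteq> 0"
  shows "whittaker_function G \<Lambda> \<mu> \<mu>' =
    (\<lambda>\<beta> \<phi>. (\<Prod>i\<in>UNIV. (of_real (symm G i) * \<mu> i * \<mu>' i) ^ \<beta> i)
        * exp (form G (\<Lambda> - root_vec \<beta>) (\<Sum>i\<in>UNIV. wscale (\<phi> i) (coroot G i)))
        * partition_function G \<Lambda> \<beta>)"
  using assms(1,6) by (intro ext) (simp add: whittaker_function_eq whit_norm)

end
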